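(* Let $n\ge 1$, let $\zeta\in\mathbb{Z}^n$, and let $P_1,\ldots,P_n\subset\mathbb{Z}^n$ be finite nonempty sets such that the tuple $(P_1,\ldots,P_n)$ is 2-developed with respect to $\zeta$. Let $(H_1,\ldots,H_n)$ and $(H'_1,\ldots,H'_n)$ be two transverse tuples of tropical hypersurfaces such that, for each $i$, both $H_i$ and $H'_i$ are defined by tropical polynomials with support $P_i$. Then $$\iota_2(H_1,\ldots,H_n;\zeta)=\iota_2(H'_1,\ldots,H'_n;\zeta)\quad\text{in }\mathbb{F}_2 .$$
   Context: Tropical polynomials and hypersurfaces. For a finite nonempty set $A\subset\mathbb{Z}^n$, a tropical polynomial with support $A$ is a function $\varphi(x)=\max_{a\in A}(c_a+a\cdot x)$, $x\in\mathbb{R}^n$, with real coefficients $c_a$, $a\in A$. For $x\in\mathbb{R}^n$ the local support set $\mathrm{supp}_x(\varphi)$ is the set of all $a\in A$ with $c_a+a\cdot x=\varphi(x)$, and the local Newton polytope is its convex hull. The tropical hypersurface $H$ defined by $\varphi$ is the set of all $x\in\mathbb{R}^n$ with $|\mathrm{supp}_x(\varphi)|\ge 2$; its local Newton polytope at $x$ is denoted $\mathcal{N}_x(H)$. A point $x\in H$ is smooth if $|\mathrm{supp}_x(\varphi)|=2$. Transversality. A tuple $(H_1,\ldots,H_n)$ of tropical hypersurfaces is transverse if $H_1\cap\ldots\cap H_n$ is finite and each of its points is a smooth point of every $H_i$. 2-determinant. For $k_1,\ldots,k_{n+1}$ in an $n$-dimensional vector space over $\mathbb{F}_2$, $\det_2(k_1,\ldots,k_{n+1})\in\mathbb{F}_2$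 is $0$ if the rank of $k_1,\ldots,k_{n+1}$ is less than $n$, and is $\lambda^1+\ldots+\lambda^{n+1}+1$ if the vectors satisfy a unique nontrivial linear relation $\lambda^1k_1+\ldots+\lambda^{n+1}k_{n+1}=0$, $\lambda^i\in\mathbb{F}_2$. 2-intersection number. For a transverse tuple and $\zeta\in\mathbb{Z}^n$, $$\iota_2(H_1,\ldots,H_n;\zeta)=\sum_{x\in H_1\cap\ldots\cap H_n}{\det}_2(\mathcal{N}_x(H_1),\ldots,\mathcal{N}_x(H_n),\zeta)\in\mathbb{F}_2,$$ where each segment $\mathcal{N}_x(H_i)$ is replaced by the mod 2 reduction of the difference of its two endpoints, and $\zeta$ by its mod 2 reduction. 2-developed tuples. For a finite set $P\subset\mathbb{Z}^n$ and a covector $v$, the support face $P^v$ is the set of points of $P$ at which $v|_P$ attains its maximum. A finite set in $\mathbb{Z}^n$ is a 2-vertex if any two of its points are congruent modulo 2 coordinatewise. The tuple $(P_1,\ldots,P_n)$ is 2-developed with respect to $\zeta$ if for every covector $v\in(\mathbb{Z}^n)^*$ with $v(\zeta)$ odd there exists $i$ such that $P_i^v$ is a 2-vertex. *)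

theory Defs
  imports "HOL-Analysis.Analysis" "HOL-Library.Z2" "HOL-Number_Theory.Cong"
begin

definition real_vec :: "int ^ 'n \<Rightarrow> real ^ 'n"
  where "real_vec a = (\<chi> j. real_of_int (a $ j))"

definition mod2_vec :: "int ^ 'n \<Rightarrow> bit ^ 'n"
  where "mod2_vec a = (\<chi> j. of_int (a $ j))"


text \<open>A tropical polynomial is given by its support \<open>A\<close> (meant to be finite and nonempty) and its
  coefficients \<open>c\<close>, of which only the restriction to \<open>A\<close> matters. Local supports, local Newton
  polytopes and smoothness depend on these data and not merely on the point set of the hypersurface,
  so a hypersurface is represented throughout by a polynomial \<open>(A, c)\<close> defining it.\<close>

definition trop_poly :: "(int ^ 'n) set \<Rightarrow> (int ^ 'n \<Rightarrow> real) \<Rightarrow> real ^ 'n \<Rightarrow> real"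
  where "trop_poly A c x = Max ((\<lambda>a. c a + real_vec a \<bullet> x) ` A)"

definition local_supp :: "(int ^ 'n) set \<Rightarrow> (int ^ 'n \<Rightarrow> real) \<Rightarrow> real ^ 'n \<Rightarrow> (int ^ 'n) set"
  where "local_supp A c x = {a \<in> A. c a + real_vec a \<bullet> x = trop_poly A c x}"

definition local_newton :: "(int ^ 'n) set \<Rightarrow> (int ^ 'n \<Rightarrow> real) \<Rightarrow> real ^ 'n \<Rightarrow> (real ^ 'n) set"
  where "local_newton A c x = convex hull (real_vec ` local_supp A c x)"

definition trop_hypersurface :: "(int ^ 'n) set \<Rightarrow> (int ^ 'n \<Rightarrow> real) \<Rightarrow> (real ^ 'n) set"
  where "trop_hypersurface A c = {x. card (local_supp A c x) \<ge> 2}"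

definition smooth_point :: "(int ^ 'n) set \<Rightarrow> (int ^ 'n \<Rightarrow> real) \<Rightarrow> real ^ 'n \<Rightarrow> bool"
  where "smooth_point A c x \<longleftrightarrow> x \<in> trop_hypersurface A c \<and> card (local_supp A c x) = 2"


text \<open>Both the coordinates and the members of an \<open>n\<close>-tuple are indexed by the type \<open>'n\<close>.\<close>

definition hypersurface_inter ::
  "('n \<Rightarrow> (int ^ 'n) set) \<Rightarrow> ('n \<Rightarrow> int ^ 'n \<Rightarrow> real) \<Rightarrow> (real ^ 'n) set"
  where "hypersurface_inter P c = (\<Inter>i. trop_hypersurface (P i) (c i))"

definition transverse :: "('n \<Rightarrow> (int ^ 'n) set) \<Rightarrow> ('n \<Rightarrow> int ^ 'n \<Rightarrow> real) \<Rightarrow> bool"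
  where "transverse P c \<longleftrightarrow> finite (hypersurface_inter P c) \<and>
    (\<forall>x \<in> hypersurface_inter P c. \<forall>i. smooth_point (P i) (c i) x)"


text \<open>The \<open>n + 1\<close> arguments of the 2-determinant are indexed by \<open>'n option\<close>. If their rank is \<open>n\<close>,
  the nontrivial linear relation is unique (lemma \<open>ex1_relation\<close> below).\<close>

definition nontrivial_relation :: "('n::finite option \<Rightarrow> bit ^ 'n) \<Rightarrow> ('n option \<Rightarrow> bit) \<Rightarrow> bool"
  where "nontrivial_relation k l \<longleftrightarrow> (\<exists>j. l j \<noteq> 0) \<and> (\<Sum>j\<in>UNIV. l j *s k j) = 0"

definition det2 :: "('n::finite option \<Rightarrow> bit ^ 'n) \<Rightarrow> bit"
  where "det2 k = (if vec.dim (range k) < CARD('n) then 0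
    else (\<Sum>j\<in>UNIV. (THE l. nontrivial_relation k l) j) + 1)"

text \<open>The mod 2 reduction of the difference of the endpoints of a nondegenerate lattice segment; it
  does not depend on the order of the endpoints (lemma \<open>segment_mod2_eq\<close> below).\<close>

definition segment_mod2 :: "(real ^ 'n) set \<Rightarrow> bit ^ 'n"
  where "segment_mod2 S = (THE k. \<exists>a b. a \<noteq> b \<and>
    S = closed_segment (real_vec a) (real_vec b) \<and> k = mod2_vec (a - b))"

definition iota2 ::
  "('n::finite \<Rightarrow> (int ^ 'n) set) \<Rightarrow> ('n \<Rightarrow> int ^ 'n \<Rightarrow> real) \<Rightarrow> int ^ 'n \<Rightarrow> bit"
  where "iota2 P c \<zeta> = (\<Sum>x \<in> hypersurface_inter P c.
    det2 (\<lambda>j. case j of None \<Rightarrow> mod2_vec \<zeta>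
                      | Some i \<Rightarrow> segment_mod2 (local_newton (P i) (c i) x)))"


text \<open>Covectors are the additive maps from \<open>int ^ 'n\<close> to \<open>int\<close>.\<close>

definition support_face :: "(int ^ 'n) set \<Rightarrow> (int ^ 'n \<Rightarrow> int) \<Rightarrow> (int ^ 'n) set"
  where "support_face P v = {p \<in> P. \<forall>q \<in> P. v q \<le> v p}"

definition two_vertex :: "(int ^ 'n) set \<Rightarrow> bool"
  where "two_vertex P \<longleftrightarrow> (\<forall>p \<in> P. \<forall>q \<in> P. \<forall>j. [p $ j = q $ j] (mod 2))"

definition two_developed :: "('n \<Rightarrow> (int ^ 'n) set) \<Rightarrow> int ^ 'n \<Rightarrow> bool"
  where "two_developed P \<zeta> \<longleftrightarrow>
    (\<forall>v. Modules.additive v \<and> odd (v \<zeta>) \<longrightarrow> (\<exists>i. two_vertex (support_face (P i) v)))"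


lemma real_vec_inj: "real_vec a = real_vec b \<longleftrightarrow> a = b"
  by (simp add: real_vec_def vec_eq_iff)

lemma segment_mod2_eq:
  assumes "a \<noteq> b"
  shows "segment_mod2 (closed_segment (real_vec a) (real_vec b)) = mod2_vec (a - b)"
proof -
  have "mod2_vec (a' - b') = mod2_vec (a - b)"
    if "closed_segment (real_vec a) (real_vec b) = closed_segment (real_vec a') (real_vec b')"
    for a' b' :: "int ^ 'a"
  proof -
    have "a = a' \<and> b = b' \<or> a = b' \<and> b = a'"
      using that by (auto simp: closed_segment_eq doubleton_eq_iff real_vec_inj)
    then show ?thesis
      by (auto simp: mod2_vec_def vec_eq_iff)
  qed
  then show ?thesis
    unfolding segment_mod2_def using assms by (intro the_equality) blast+
qed

lemma segment_mod2_local_newton: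
  assumes "local_supp A c x = {a, b}" and "a \<noteq> b"
  shows "segment_mod2 (local_newton A c x) = mod2_vec (a - b)"
  using assms by (simp add: local_newton_def segment_mod2_eq flip: segment_convex_hull)

lemma ex1_relation:
  fixes k :: "'n::finite option \<Rightarrow> bit ^ 'n"
  assumes "\<not> vec.dim (range k) < CARD('n)"
  shows "\<exists>!l. nontrivial_relation k l"
proof -
  define L :: "bit ^ ('n option) \<Rightarrow> bit ^ 'n" where "L l = (\<Sum>j\<in>UNIV. (l $ j) *s k j)" for l
  have L_add: "L (l + m) = L l + L m" for l m
    unfolding L_def vector_add_component vec.scale_left_distrib by (rule sum.distrib)
  have L_scale: "L (r *s l) = r *s L l" for r l
    by (simp add: L_def vec.scale_sum_right)
  have L_0: "L 0 = 0"
    by (simp add: L_def)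
  have k_L: "k j = L (axis j 1)" for j
  proof -
    have "L (axis j 1) = (\<Sum>i\<in>UNIV. if i = j then k i else 0)"
      unfolding L_def by (rule sum.cong) (auto simp: axis_def)
    then show ?thesis
      by simp
  qed
  have "vec.subspace (range L)"
    unfolding vec.subspace_def
    by (auto simp: L_0 simp flip: L_add L_scale intro: range_eqI[of _ _ 0])
  then have "vec.span (range k) \<subseteq> range L"
    by (intro vec.span_minimal) (auto simp: k_L)
  moreover have "vec.span (range k) = UNIV"
    using assms dim_subset_UNIV_cart_gen[of "range k"]
    by (metis le_antisym not_less vec.dim_eq_full vec.span_UNIV vec_dim_card)
  ultimately have surj: "surj L"
    by blast
  have fibre: "card (L -` {y}) = card (L -` {0})" for y
  proof -
    obtain m where m: "y = L m"
      using surj by blast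
    have L_diff: "L (l - m) = L l - L m" for l
      using L_add[of "l - m" m] by (metis add_diff_cancel_right' diff_add_cancel)
    have "bij_betw (\<lambda>l. l + m) (L -` {0}) (L -` {y})"
    proof (rule bij_betwI[where g = "\<lambda>l. l - m"])
      show "(\<lambda>l. l + m) \<in> L -` {0} \<rightarrow> L -` {y}"
        by (auto simp: m L_add)
      show "(\<lambda>l. l - m) \<in> L -` {y} \<rightarrow> L -` {0}"
        unfolding m Pi_iff Ball_def vimage_singleton_eq L_diff by (metis diff_self)
    qed (rule add_diff_cancel_right', rule diff_add_cancel)
    then show ?thesis
      by (simp add: bij_betw_same_card)
  qed
  have "(UNIV :: bit set) = {0, 1}"
    by (auto intro: bit.exhaust)
  then have card_bit: "CARD(bit) = 2"
    by (metis card_2_iff zero_neq_one)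
  have fin: "finite (UNIV :: (bit ^ ('n option)) set)" "finite (UNIV :: (bit ^ 'n) set)"
    by (rule card_ge_0_finite, simp add: card_bit)+
  have "card (UNIV :: (bit ^ ('n option)) set) = card (\<Union>y. L -` {y})"
    by (rule arg_cong[where f = card]) auto
  also have "\<dots> = (\<Sum>y\<in>UNIV. card (L -` {y}))"
    using fin by (intro card_UN_disjoint) (auto intro: finite_subset)
  also have "\<dots> = card (UNIV :: (bit ^ 'n) set) * card (L -` {0})"
    by (subst fibre) simp
  finally have "card (L -` {0}) = 2"
    by (simp add: card_bit card_UNIV_option)
  then obtain x y where xy: "L -` {0} = {x, y}" "x \<noteq> y"
    unfolding card_2_iff by blast
  have "0 \<in> L -` {0}"
    unfolding vimage_singleton_eq by (rule L_0)
  then have "x = 0 \<or> y = 0"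
    unfolding xy(1) by blast
  then have "L -` {0} = {0, if x = 0 then y else x} \<and> (if x = 0 then y else x) \<noteq> 0"
    using xy(2) unfolding xy(1) by (auto split: if_splits)
  then obtain l where l: "L -` {0} = {0, l}" "l \<noteq> 0"
    by (elim conjE that)
  have rel: "nontrivial_relation k m \<longleftrightarrow> (\<chi> j. m j) = l" for m
  proof -
    have "(\<exists>j. m j \<noteq> 0) \<longleftrightarrow> (\<chi> j. m j) \<noteq> 0"
      unfolding vec_eq_iff zero_index vec_lambda_beta by blast
    moreover have "(\<Sum>j\<in>UNIV. m j *s k j) = 0 \<longleftrightarrow> (\<chi> j. m j) \<in> L -` {0}"
      unfolding vimage_singleton_eq L_def vec_lambda_beta by (rule refl)
    ultimately have "nontrivial_relation k m \<longleftrightarrow> (\<chi> j. m j) \<noteq> 0 \<and> (\<chi> j. m j) \<in> {0, l}"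
      unfolding nontrivial_relation_def l(1) by (rule arg_cong2[where f = conj])
    then show ?thesis
      using l(2) by blast
  qed
  show ?thesis
    unfolding rel by (metis vec_lambda_inverse UNIV_I vec_nth_inverse)
qed

end

theory Submission
  imports Defs
begin

text \<open>The 2-determinant is additive in each argument, so the weight
  \<open>det\<^sub>2 (k\<^sub>1, \<dots>, k\<^sub>n, \<zeta>)\<close> is balanced at a vertex where one local support has three points. Join \<open>c\<close>
  to a generic \<open>d\<close> by the segment \<open>(1 - t) c + t d\<close>. Over \<open>0 \<le> t \<le> 1\<close> the intersection points of
  nonzero weight trace a finite graph: by Cramer's rule an unbounded edge has a direction on which \<open>\<zeta>\<close>
  takes an odd value, and two-developedness then makes its weight vanish. Counting the ends of the edges
  modulo 2 in two ways, the interior vertices cancel by additivity, and the ends at \<open>t = 0\<close> and \<open>t = 1\<close>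
  give the two intersection numbers.\<close>

section \<open>Additivity of the 2-determinant\<close>

text \<open>The segment from \<open>c\<close> to \<open>c'\<close> leaves no freedom to avoid
  degenerate positions, so both are joined to one common \<open>d\<close>. Even then the start
  \<open>c\<close> is not generic: transversality controls only those points at which every
  polynomial attains its maximum at least twice. Independence of the tight constraints is therefore
  claimed only along edges of nonzero weight, where each local support keeps at least two points.
  Nothing is claimed about transversality of \<open>d\<close>, so both ends are measured by a sum
  over points of nonzero weight.

  The number \<open>2 * CARD('n) + 1\<close> is the dimension of the space of points
  \<open>x\<close>, values \<open>y\<close> of the polynomials and times \<open>t\<close>. An edge
  has two tight terms per polynomial. A vertex has one tight constraint more: a bound on
  \<open>t\<close>, or a third term of one polynomial.\<close>

lemma span_image_finite_obtain:
  fixes k :: "'j \<Rightarrow> 'a::field ^ 'n"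
  assumes "finite I" "u \<in> vec.span (k ` I)"
  obtains m where "u = (\<Sum>j\<in>I. m j *s k j)"
proof -
  define W where "W = range (\<lambda>m. \<Sum>j\<in>I. m j *s k j)"
  have "vec.subspace W"
    unfolding vec.subspace_def
  proof (intro conjI ballI allI)
    show "0 \<in> W"
      unfolding W_def by (rule range_eqI[of _ _ "\<lambda>_. 0"]) simp
  next
    fix x y assume "x \<in> W" "y \<in> W"
    then obtain m m' where "x = (\<Sum>j\<in>I. m j *s k j)" "y = (\<Sum>j\<in>I. m' j *s k j)"
      unfolding W_def by blast
    then show "x + y \<in> W"
      unfolding W_def
      by (intro range_eqI[of _ _ "\<lambda>j. m j + m' j"]) (simp add: vec.scale_left_distrib sum.distrib)
  next
    fix r x assume "x \<in> W"
    then obtain m where "x = (\<Sum>j\<in>I. m j *s k j)"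
      unfolding W_def by blast
    then show "r *s x \<in> W"
      unfolding W_def by (intro range_eqI[of _ _ "\<lambda>j. r * m j"]) (simp add: vec.scale_sum_right)
  qed
  moreover have "k ` I \<subseteq> W"
  proof
    fix x assume "x \<in> k ` I"
    then obtain i where "i \<in> I" "x = k i" by blast
    moreover have "(\<Sum>j\<in>I. (if j = i then 1 else 0) *s k j) = (\<Sum>j\<in>I. if j = i then k j else 0)"
      by (rule sum.cong) auto
    ultimately show "x \<in> W"
      unfolding W_def using assms(1) by (intro range_eqI[of _ _ "\<lambda>j. if j = i then 1 else 0"]) simp
  qed
  ultimately have "u \<in> W"
    using assms(2) vec.span_minimal by blast
  then show thesis
    using that unfolding W_def by blast
qed

lemma bit_vec_add_self: "x + x = (0 :: bit ^ 'n)"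
  by (simp add: vec_eq_iff)

lemma bit_vec_add_eq_0_iff: "x + y = 0 \<longleftrightarrow> x = (y :: bit ^ 'n)"
  by (metis bit_vec_add_self add.assoc add_0)

lemma full_rank_iff_span:
  fixes k :: "'n::finite option \<Rightarrow> bit ^ 'n"
  shows "vec.dim (range k) < CARD('n) \<longleftrightarrow> vec.span (range k) \<noteq> UNIV"
  by (metis dim_subset_UNIV_cart_gen order_less_le vec.dim_eq_full vec.span_UNIV vec_dim_card)

lemma det2_eq_0_if_not_span:
  fixes k :: "'n::finite option \<Rightarrow> bit ^ 'n"
  assumes "vec.span (range k) \<noteq> UNIV"
  shows "det2 k = 0"
  using assms by (simp add: det2_def full_rank_iff_span)

lemma det2_eq_relation:
  fixes k :: "'n::finite option \<Rightarrow> bit ^ 'n"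
  assumes "vec.span (range k) = UNIV" "nontrivial_relation k l"
  shows "det2 k = (\<Sum>j\<in>UNIV. l j) + 1"
proof -
  have n: "\<not> vec.dim (range k) < CARD('n)"
    using assms(1) by (simp add: full_rank_iff_span)
  then have "(THE l. nontrivial_relation k l) = l"
    using ex1_relation[OF n] assms(2) by (blast intro: the1_equality)
  then show ?thesis
    using n by (simp add: det2_def)
qed

lemma range_fun_upd: "range (k(i := u)) = insert u (k ` (- {i}))"
  by (auto simp: image_iff)

lemma sum_fun_upd:
  fixes k :: "'j::finite \<Rightarrow> 'a::field ^ 'n"
  shows "(\<Sum>j\<in>UNIV. l j *s (k(i := u)) j) = l i *s u + (\<Sum>j\<in>-{i}. l j *s k j)"
proof -
  have "(\<Sum>j\<in>UNIV. l j *s (k(i := u)) j) = l i *s u + (\<Sum>j\<in>UNIV-{i}. l j *s (k(i := u)) j)"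
    by (subst sum.remove[of UNIV i]) auto
  also have "(\<Sum>j\<in>UNIV-{i}. l j *s (k(i := u)) j) = (\<Sum>j\<in>-{i}. l j *s k j)"
    by (rule sum.cong) auto
  finally show ?thesis .
qed

lemma nontrivial_relation_upd:
  "nontrivial_relation (k(i := u)) l \<longleftrightarrow>
    (\<exists>j. l j \<noteq> 0) \<and> l i *s u + (\<Sum>j\<in>-{i}. l j *s k j) = 0"
  unfolding nontrivial_relation_def sum_fun_upd ..

lemma span_insert_cong:
  fixes u :: "bit ^ 'n"
  assumes "u + v + w = 0" "w \<in> vec.span S"
  shows "vec.span (insert u S) = vec.span (insert v S)"
proof -
  have *: "vec.span (insert u S) \<subseteq> vec.span (insert v S)" if "u + v + w = 0" for u v :: "bit ^ 'n"
  proof -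
    have "u = v + w"
      using that by (metis bit_vec_add_eq_0_iff add.assoc)
    moreover have "v + w \<in> vec.span (insert v S)"
      using assms(2) by (meson vec.span_add vec.span_base insertI1 vec.span_mono subsetD subset_insertI)
    moreover have "S \<subseteq> vec.span (insert v S)"
      using vec.span_superset[of "insert v S"] by blast
    ultimately show ?thesis
      by (intro vec.span_minimal[OF _ vec.subspace_span]) simp
  qed
  show ?thesis
    using *[of u v] *[of v u] assms(1) by (simp add: add.commute)
qed

text \<open>A vector outside the span of the others does not take part in the relation.\<close>

lemma det2_upd_outside_span:
  fixes k :: "'n::finite option \<Rightarrow> bit ^ 'n"
  assumes "u + v + w = 0" "w \<in> vec.span (k ` (- {i}))" "u \<notin> vec.span (k ` (- {i}))"
  shows "det2 (k(i := u)) = det2 (k(i := v))"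
proof (cases "vec.span (range (k(i := u))) = UNIV")
  case False
  moreover have "vec.span (range (k(i := u))) = vec.span (range (k(i := v)))"
    unfolding range_fun_upd using assms(1,2) by (rule span_insert_cong)
  ultimately show ?thesis
    by (simp add: det2_eq_0_if_not_span)
next
  case True
  moreover have "vec.span (range (k(i := u))) = vec.span (range (k(i := v)))"
    unfolding range_fun_upd using assms(1,2) by (rule span_insert_cong)
  ultimately have v: "vec.span (range (k(i := v))) = UNIV"
    by simp
  obtain l where l: "nontrivial_relation (k(i := u)) l"
    using ex1_relation[of "k(i := u)"] True full_rank_iff_span by blast
  have "l i = 0"
  proof (rule ccontr)
    assume "l i \<noteq> 0"
    then have "u + (\<Sum>j\<in>-{i}. l j *s k j) = 0"
      using l unfolding nontrivial_relation_upd by simp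
    then have "u = (\<Sum>j\<in>-{i}. l j *s k j)"
      by (simp only: bit_vec_add_eq_0_iff)
    also have "\<dots> \<in> vec.span (k ` (- {i}))"
      by (intro vec.span_sum vec.span_scale vec.span_base) auto
    finally show False
      using assms(3) by simp
  qed
  then have "nontrivial_relation (k(i := v)) l"
    using l unfolding nontrivial_relation_upd by simp
  then show ?thesis
    using l True v by (simp add: det2_eq_relation)
qed

text \<open>The question is whether the remaining \<open>CARD('n)\<close> vectors form a basis. If
  so, \<open>det2\<close> is the coefficient sum of the new vector in that basis; if not, everything
  depends on the position of \<open>u\<close>, \<open>v\<close>, \<open>w\<close> relative to their
  span.\<close>

lemma det2_additive:
  fixes k :: "'n::finite option \<Rightarrow> bit ^ 'n"
  assumes "u + v + w = 0"
  shows "det2 (k(i := u)) + det2 (k(i := v)) + det2 (k(i := w)) = 0"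
proof (cases "vec.span (k ` (- {i})) = UNIV")
  case True
  have full: "vec.span (range (k(i := x))) = UNIV" for x
    unfolding range_fun_upd using True by (metis subset_insertI top.extremum_uniqueI vec.span_mono)
  have ex: "\<exists>m. x = (\<Sum>j\<in>-{i}. m j *s k j)" for x
    using span_image_finite_obtain[of "-{i}" x k] True by (metis UNIV_I finite)
  \<comment> \<open>The relation consists of \<open>x\<close> and its expansion. Its coefficient at
    \<open>i\<close> is 1, which the \<open>+ 1\<close> in \<open>det2\<close> cancels, so the value
    becomes linear in \<open>m\<close>.\<close>
  have D: "det2 (k(i := x)) = (\<Sum>j\<in>-{i}. m j)" if "x = (\<Sum>j\<in>-{i}. m j *s k j)" for x m
  proof -
    have "(\<Sum>j\<in>-{i}. (m(i := 1)) j *s k j) = (\<Sum>j\<in>-{i}. m j *s k j)"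
      by (rule sum.cong) auto
    then have "(\<Sum>j\<in>UNIV. (m(i := 1)) j *s (k(i := x)) j) = x + x"
      unfolding sum_fun_upd using that by (simp only: fun_upd_same vector_smult_lid)
    then have "nontrivial_relation (k(i := x)) (m(i := 1))"
      unfolding nontrivial_relation_def bit_vec_add_self by (intro conjI exI[of _ i]) auto
    then have "det2 (k(i := x)) = (\<Sum>j\<in>UNIV. (m(i := 1)) j) + 1"
      by (rule det2_eq_relation[OF full])
    also have "(\<Sum>j\<in>UNIV. (m(i := 1)) j) = 1 + (\<Sum>j\<in>UNIV-{i}. (m(i := 1)) j)"
      by (subst sum.remove[of UNIV i]) auto
    also have "(\<Sum>j\<in>UNIV-{i}. (m(i := 1)) j) = (\<Sum>j\<in>-{i}. m j)"
      by (rule sum.cong) auto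
    finally have "det2 (k(i := x)) = (1 + 1) + (\<Sum>j\<in>-{i}. m j)"
      by (simp only: ac_simps)
    then show ?thesis
      by (simp only: one_add_one bit_2_eq_0 add_0)
  qed
  obtain m m' where m: "u = (\<Sum>j\<in>-{i}. m j *s k j)" "v = (\<Sum>j\<in>-{i}. m' j *s k j)"
    using ex by blast
  have "w = u + v"
    using assms unfolding bit_vec_add_eq_0_iff by simp
  then have w: "w = (\<Sum>j\<in>-{i}. (m j + m' j) *s k j)"
    unfolding m vec.scale_left_distrib sum.distrib .
  have "x + y + (x + y) = 0" for x y :: bit
    by (cases x; cases y) simp_all
  then show ?thesis
    unfolding D[OF m(1)] D[OF m(2)] D[OF w] sum.distrib .
next
  case False
  let ?W = "vec.span (k ` (- {i}))"
  have inside: "det2 (k(i := x)) = 0" if "x \<in> ?W" for x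
    using vec.span_redundant[OF that] False
    by (intro det2_eq_0_if_not_span) (simp only: range_fun_upd not_False_eq_True)
  have w: "w = u + v"
    using assms unfolding bit_vec_add_eq_0_iff by simp
  have perm: "v + w + u = 0" "u + w + v = 0"
    using assms by (simp_all add: ac_simps)
  \<comment> \<open>Since the three vectors add up to 0, all of them, exactly one or none lie in
    \<open>?W\<close>.\<close>
  consider "u \<in> ?W" "v \<in> ?W" | "u \<in> ?W" "v \<notin> ?W" | "u \<notin> ?W" "v \<in> ?W"
    | "u \<notin> ?W" "w \<in> ?W" | "u \<notin> ?W" "v \<notin> ?W" "w \<notin> ?W"
    by blast
  then show ?thesis
  proof cases
    case 1
    then show ?thesis
      by (simp add: w inside vec.span_add)
  next
    case 2
    then show ?thesis
      using det2_upd_outside_span[OF perm(1)] inside by simp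
  next
    case 3
    then show ?thesis
      using det2_upd_outside_span[OF perm(2)] inside by simp
  next
    case 4
    then show ?thesis
      using det2_upd_outside_span[OF assms] inside by simp
  next
    case 5
    \<comment> \<open>Over the field with two elements, \<open>y\<close> and \<open>x + y\<close>
      both lying outside \<open>?W\<close> means that \<open>y\<close> is outside the span of
      \<open>?W\<close> and \<open>x\<close>. So one added vector cannot complete \<open>?W\<close>
      to the whole space.\<close>
    have zero: "det2 (k(i := x)) = 0" if "y \<notin> ?W" "x + y \<notin> ?W" for x y
    proof (rule det2_eq_0_if_not_span)
      have "y \<notin> vec.span (insert x (k ` (- {i})))"
      proof
        assume "y \<in> vec.span (insert x (k ` (- {i})))"
        then obtain r where "y - r *s x \<in> ?W"
          by (auto simp: vec.span_breakdown_eq)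
        moreover have "r = 0 \<or> r = 1"
          by (cases r) auto
        moreover have "y - x = x + y"
          unfolding diff_eq_eq by (metis bit_vec_add_self add.assoc add.commute add_0)
        ultimately show False
          using that by (metis diff_zero vector_smult_lid vector_smult_lzero)
      qed
      then show "vec.span (range (k(i := x))) \<noteq> UNIV"
        unfolding range_fun_upd by blast
    qed
    have "w + u + v = 0"
      using assms by (simp add: ac_simps)
    then have "w + u = v" "v + u = w" "u + v = w" "u + w = v"
      unfolding bit_vec_add_eq_0_iff using w by (simp_all add: add.commute)
    then show ?thesis
      using 5 zero[of v u] zero[of u v] zero[of u w] zero[of w u] by simp
  qed
qed

text \<open>Additivity for 0 + 0 + 0 = 0 adds the same value three times, and in characteristic 2
  this is the value itself.\<close>

lemma det2_zero_arg:
  fixes k :: "'n::finite option \<Rightarrow> bit ^ 'n"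
  assumes "k i = 0"
  shows "det2 k = 0"
  using det2_additive[of 0 0 0 k i] assms by (simp add: fun_upd_idem)

text \<open>The relation cannot involve \<open>None\<close> alone: its coefficient sum would be 1
  and the determinant 1 + 1 = 0. So a vector with an index \<open>Some i\<close> is redundant, and
  the slot \<open>None\<close>, which will hold \<open>\<zeta>\<close>, stays in the spanning
  family.\<close>

lemma det2_nonzero_obtain_span:
  fixes k :: "'n::finite option \<Rightarrow> bit ^ 'n"
  assumes "det2 k \<noteq> 0"
  obtains i where "vec.span (k ` (- {Some i})) = UNIV"
proof -
  have full: "vec.span (range k) = UNIV"
    using assms det2_eq_0_if_not_span by blast
  obtain l where l: "nontrivial_relation k l"
    using ex1_relation[of k] full full_rank_iff_span by blast
  have "\<exists>i. l (Some i) \<noteq> 0"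
  proof (rule ccontr)
    assume *: "\<nexists>i. l (Some i) \<noteq> 0"
    then have "l None \<noteq> 0"
      using l unfolding nontrivial_relation_def by (metis option.exhaust)
    with * have "(\<Sum>j\<in>UNIV. l j) = 1"
      by (simp add: UNIV_option_conv sum.reindex)
    then show False
      using assms det2_eq_relation[OF full l] by simp
  qed
  then obtain i where "l (Some i) = 1"
    by auto
  let ?i = "Some i"
  have "k ?i + (\<Sum>j\<in>-{?i}. l j *s k j) = 0"
    using l sum_fun_upd[of l k ?i "k ?i"] \<open>l ?i = 1\<close> by (simp add: nontrivial_relation_def)
  then have "k ?i = (\<Sum>j\<in>-{?i}. l j *s k j)"
    by (simp only: bit_vec_add_eq_0_iff)
  also have "\<dots> \<in> vec.span (k ` (- {?i}))"
    by (intro vec.span_sum vec.span_scale vec.span_base) auto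
  finally have "vec.span (insert (k ?i) (k ` (- {?i}))) = vec.span (k ` (- {?i}))"
    by (rule vec.span_redundant)
  then have "vec.span (k ` (- {?i})) = UNIV"
    using full range_fun_upd[of k ?i "k ?i"] by simp
  then show thesis
    by (rule that)
qed

section \<open>Edges of a simple polyhedron\<close>

text \<open>A notion for families and not for sets: a repeated vector counts as a
  dependence.\<close>

definition independent_family :: "'j set \<Rightarrow> ('j \<Rightarrow> 'a::real_vector) \<Rightarrow> bool"
  where "independent_family J r \<longleftrightarrow> (\<forall>\<mu>. (\<Sum>j\<in>J. \<mu> j *\<^sub>R r j) = 0 \<longrightarrow> (\<forall>j\<in>J. \<mu> j = 0))"

lemma independent_family_subset:
  assumes "independent_family J r" "finite J" "I \<subseteq> J"
  shows "independent_family I r"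
  unfolding independent_family_def
proof (intro allI impI ballI)
  fix \<mu> j assume *: "(\<Sum>j\<in>I. \<mu> j *\<^sub>R r j) = 0" "j \<in> I"
  have "(\<Sum>j\<in>J. (if j \<in> I then \<mu> j else 0) *\<^sub>R r j) = (\<Sum>j\<in>I. \<mu> j *\<^sub>R r j)"
    using assms(2,3) by (intro sum.mono_neutral_cong_right) auto
  then have "(\<Sum>j\<in>J. (if j \<in> I then \<mu> j else 0) *\<^sub>R r j) = 0"
    using *(1) by simp
  then have "\<forall>j\<in>J. (if j \<in> I then \<mu> j else 0) = 0"
    by (rule assms(1)[unfolded independent_family_def, rule_format, THEN ballI])
  with *(2) assms(3) show "\<mu> j = 0"
    by (auto dest: bspec[of _ _ j])
qed

lemma independent_family_inj_independent:
  assumes "finite J" "independent_family J r"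
  shows "inj_on r J" "independent (r ` J)"
proof -
  show inj: "inj_on r J"
  proof (rule inj_onI, rule ccontr)
    fix i j assume ij: "i \<in> J" "j \<in> J" "r i = r j" "i \<noteq> j"
    have "independent_family {i, j} r"
      using assms ij by (intro independent_family_subset[OF assms(2,1)]) auto
    moreover have "(\<Sum>k\<in>{i,j}. (if k = i then 1 else - 1) *\<^sub>R r k) = 0"
      using ij by simp
    ultimately show False
      unfolding independent_family_def by (auto dest: spec[of _ "\<lambda>k. if k = i then 1 else - 1"])
  qed
  show "independent (r ` J)"
    unfolding real_vector.independent_explicit_finite_subsets independent_explicit
  proof (intro allI impI ballI)
    fix S u v assume S: "S \<subseteq> r ` J" "finite S" and u: "(\<Sum>v\<in>S. u v *\<^sub>R v) = 0" and v: "v \<in> S"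
    then obtain I where I: "I \<subseteq> J" "S = r ` I"
      by (meson subset_image_iff)
    have "(\<Sum>j\<in>I. u (r j) *\<^sub>R r j) = 0"
      using u inj I by (subst (asm) I(2), subst (asm) sum.reindex) (auto intro: inj_on_subset)
    moreover have "independent_family I r"
      using independent_family_subset[OF assms(2,1) I(1)] .
    ultimately show "u v = 0"
      using v I(2) unfolding independent_family_def
      by (auto dest!: spec[of _ "\<lambda>j. u (r j)"])
  qed
qed

lemma independent_family_card_le:
  fixes r :: "'j \<Rightarrow> 'a::euclidean_space"
  assumes "finite J" "independent_family J r"
  shows "card J \<le> DIM('a)"
  using independent_family_inj_independent[OF assms] independent_bound[of "r ` J"]
  by (simp add: card_image)

lemma orthogonal_span:
  assumes "x \<in> span S" "\<And>y. y \<in> S \<Longrightarrow> y \<bullet> w = 0"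
  shows "x \<bullet> w = 0"
  using assms by (induct rule: span_induct_alt) (auto simp: inner_add_left)

lemma independent_family_orthogonal_zero:
  fixes r :: "'j \<Rightarrow> 'a::euclidean_space"
  assumes "finite J" "independent_family J r" "card J = DIM('a)"
    and "\<And>j. j \<in> J \<Longrightarrow> r j \<bullet> w = 0"
  shows "w = 0"
proof -
  have "dim (r ` J) = DIM('a)"
    using independent_family_inj_independent[OF assms(1,2)] assms(3)
    by (simp add: dim_eq_card_independent card_image)
  then have "w \<in> span (r ` J)"
    by (simp add: dim_eq_full)
  then have "w \<bullet> w = 0"
    using assms(4) by (intro orthogonal_span[of w "r ` J"]) auto
  then show ?thesis by simp
qed

lemma orthogonal_nonzero_exists:
  fixes r :: "'j \<Rightarrow> 'a::euclidean_space"
  assumes "finite J" "card J < DIM('a)"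
  obtains w where "w \<noteq> 0" "\<And>j. j \<in> J \<Longrightarrow> r j \<bullet> w = 0"
proof -
  have "dim (r ` J) < DIM('a)"
    using dim_le_card'[of "r ` J"] card_image_le[OF assms(1), of r] assms by simp
  then obtain w where "w \<noteq> 0" "\<And>y. y \<in> span (r ` J) \<Longrightarrow> orthogonal w y"
    by (rule orthogonal_to_subspace_exists) blast
  then have "r j \<bullet> w = 0" if "j \<in> J" for j
    using that by (metis imageI inner_commute orthogonal_def span_base)
  then show thesis
    using that \<open>w \<noteq> 0\<close> by blast
qed

text \<open>The family and \<open>w\<close> together span the space. The part of \<open>u\<close>
  orthogonal to \<open>w\<close> is orthogonal to all of them, hence zero.\<close>

lemma orthogonal_line:
  fixes r :: "'j \<Rightarrow> 'a::euclidean_space"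
  assumes "finite E" "independent_family E r" "card E + 1 = DIM('a)"
    and w: "w \<noteq> 0" "\<And>i. i \<in> E \<Longrightarrow> r i \<bullet> w = 0"
    and u: "\<And>i. i \<in> E \<Longrightarrow> r i \<bullet> u = 0"
  obtains s where "u = s *\<^sub>R w"
proof -
  have orth: "x \<bullet> w = 0" if "x \<in> span (r ` E)" for x
    using orthogonal_span[OF that] w(2) by blast
  have notin: "w \<notin> span (r ` E)"
  proof
    assume "w \<in> span (r ` E)"
    then have "w \<bullet> w = 0"
      by (rule orth)
    then show False
      using w(1) by simp
  qed
  then have "w \<notin> r ` E"
    using span_base[of w "r ` E"] by blast
  then have "independent (insert w (r ` E))" "card (insert w (r ` E)) = DIM('a)"
    using independent_family_inj_independent[OF assms(1,2)] notin assms(1,3)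
    by (simp_all add: independent_insertI card_image)
  then have "span (insert w (r ` E)) = UNIV"
    by (metis dim_eq_card_independent dim_eq_full)
  moreover define u' where "u' = u - ((w \<bullet> u) / (w \<bullet> w)) *\<^sub>R w"
  ultimately have "u' \<in> span (insert w (r ` E))"
    by simp
  then have "u' \<bullet> u' = 0"
    by (rule orthogonal_span) (use w u in \<open>auto simp: u'_def inner_diff_right\<close>)
  then have "u = ((w \<bullet> u) / (w \<bullet> w)) *\<^sub>R w"
    by (simp add: u'_def)
  then show thesis
    by (rule that)
qed

section \<open>Polyhedra, their closed faces and the ends of edges\<close>

definition feasible :: "'j set \<Rightarrow> ('j \<Rightarrow> 'a::euclidean_space) \<Rightarrow> ('j \<Rightarrow> real) \<Rightarrow> 'a set"
  where "feasible J r c = {p. \<forall>j\<in>J. r j \<bullet> p + c j \<le> 0}"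

definition active :: "'j set \<Rightarrow> ('j \<Rightarrow> 'a::euclidean_space) \<Rightarrow> ('j \<Rightarrow> real) \<Rightarrow> 'a \<Rightarrow> 'j set"
  where "active J r c p = {j \<in> J. r j \<bullet> p + c j = 0}"

text \<open>Closed faces: constraints outside \<open>E\<close> may be tight too, so an edge contains
  its ends.\<close>

definition feasible_face ::
    "'j set \<Rightarrow> ('j \<Rightarrow> 'a::euclidean_space) \<Rightarrow> ('j \<Rightarrow> real) \<Rightarrow> 'j set \<Rightarrow> 'a set"
  where "feasible_face J r c E = {p \<in> feasible J r c. E \<subseteq> active J r c p}"

lemma finite_active: "finite J \<Longrightarrow> finite (active J r c p)"
  by (simp add: active_def)

text \<open>Only tight constraints restrict the direction; the finitely many others have slack that
  survives a small step.\<close>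

lemma feasible_move:
  assumes "finite J" "p \<in> feasible J r c" and "\<And>j. j \<in> active J r c p \<Longrightarrow> r j \<bullet> w \<le> 0"
  obtains e where "e > 0" "p + e *\<^sub>R w \<in> feasible J r c"
proof -
  have "\<forall>\<^sub>F e in at_right 0. r j \<bullet> (p + e *\<^sub>R w) + c j \<le> 0" if "j \<in> J" for j
  proof (cases "j \<in> active J r c p")
    case True
    have "\<forall>\<^sub>F e :: real in at_right 0. e > 0"
      by (rule eventually_at_right_less)
    then show ?thesis
    proof eventually_elim
      case (elim e)
      then have "e * (r j \<bullet> w) \<le> 0"
        using assms(3)[OF True] by (simp add: mult_nonneg_nonpos)
      then show ?case
        using True by (simp add: active_def inner_add_right)
    qed
  next
    case False
    then have "r j \<bullet> p + c j < 0"
      using that assms(2) by (force simp: active_def feasible_def)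
    moreover have "((\<lambda>e. r j \<bullet> (p + e *\<^sub>R w) + c j) \<longlongrightarrow> r j \<bullet> (p + 0 *\<^sub>R w) + c j) (at_right 0)"
      by (intro tendsto_intros)
    ultimately have "\<forall>\<^sub>F e in at_right 0. r j \<bullet> (p + e *\<^sub>R w) + c j < 0"
      by (intro order_tendstoD(2)) auto
    then show ?thesis
      by eventually_elim simp
  qed
  then have "\<forall>\<^sub>F e in at_right 0. \<forall>j\<in>J. r j \<bullet> (p + e *\<^sub>R w) + c j \<le> 0"
    using assms(1) by (intro eventually_ball_finite) auto
  then have "\<forall>\<^sub>F e in at_right 0. e > 0 \<and> (\<forall>j\<in>J. r j \<bullet> (p + e *\<^sub>R w) + c j \<le> 0)"
    using eventually_at_right_less by (rule eventually_conj[rotated])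
  then obtain e :: real where "e > 0" "\<forall>j\<in>J. r j \<bullet> (p + e *\<^sub>R w) + c j \<le> 0"
    using eventually_happens'[OF trivial_limit_at_right_real] by blast
  then show thesis
    using that by (auto simp: feasible_def)
qed

lemma feasible_face_move:
  assumes "finite J" "p \<in> feasible_face J r c E" and "\<And>j. j \<in> active J r c p \<Longrightarrow> r j \<bullet> w \<le> 0"
    and "\<And>j. j \<in> E \<Longrightarrow> r j \<bullet> w = 0"
  obtains e where "e > 0" "p + e *\<^sub>R w \<in> feasible_face J r c E"
proof -
  obtain e where e: "e > 0" "p + e *\<^sub>R w \<in> feasible J r c"
    using feasible_move[of J p r c w, OF assms(1) _ assms(3)] assms(2) unfolding feasible_face_def by blast
  then have "p + e *\<^sub>R w \<in> feasible_face J r c E"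
    using assms(2,4) by (auto simp: feasible_face_def active_def inner_add_right)
  then show thesis
    using e(1) that by blast
qed

lemma closed_feasible_face: "closed (feasible_face J r c E)"
proof -
  have "feasible_face J r c E =
      (\<Inter>j\<in>J. {p. r j \<bullet> p + c j \<le> 0}) \<inter> (\<Inter>j\<in>E. {p. j \<in> J \<and> r j \<bullet> p + c j = 0})"
    by (auto simp: feasible_face_def feasible_def active_def)
  moreover have "closed {p. r j \<bullet> p + c j \<le> 0}" for j
    by (intro closed_Collect_le continuous_intros)
  moreover have "closed {p. j \<in> J \<and> r j \<bullet> p + c j = 0}" for j
    by (cases "j \<in> J") (auto intro!: closed_Collect_eq continuous_intros)
  ultimately show ?thesis
    by (auto intro!: closed_Int closed_INT)
qed

lemma convex_feasible_face: "convex (feasible_face J r c E)"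
proof (rule convexI)
  fix x y and u v :: real
  assume x: "x \<in> feasible_face J r c E" and y: "y \<in> feasible_face J r c E"
    and uv: "0 \<le> u" "0 \<le> v" "u + v = 1"
  have eq: "r j \<bullet> (u *\<^sub>R x + v *\<^sub>R y) + c j = u * (r j \<bullet> x + c j) + v * (r j \<bullet> y + c j)" for j
  proof -
    have "c j = (u + v) * c j"
      using uv by simp
    then show ?thesis
      by (simp add: inner_add_right algebra_simps)
  qed
  have "u * (r j \<bullet> x + c j) + v * (r j \<bullet> y + c j) \<le> 0" if "j \<in> J" for j
    using x y uv that unfolding feasible_face_def feasible_def
    by (intro add_nonpos_nonpos[OF mult_nonneg_nonpos mult_nonneg_nonpos]) auto
  moreover have "r j \<bullet> x + c j = 0" "r j \<bullet> y + c j = 0" "j \<in> J" if "j \<in> E" for j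
    using x y that unfolding feasible_face_def active_def by auto
  ultimately show "u *\<^sub>R x + v *\<^sub>R y \<in> feasible_face J r c E"
    unfolding feasible_face_def feasible_def active_def mem_Collect_eq subset_iff eq by simp
qed

text \<open>A nonempty face lies on a line. \<open>norec\<close> bounds it in both directions, so it
  is a segment, and \<open>indep\<close> makes it nondegenerate with exactly its two ends as
  vertices. The count is therefore 0 or 2.\<close>

lemma even_card_face_vertices:
  fixes r :: "'j \<Rightarrow> 'a::euclidean_space"
  assumes J: "finite J" and E: "E \<subseteq> J" "card E + 1 = DIM('a)"
    and indep: "\<And>p. p \<in> feasible_face J r c E \<Longrightarrow> independent_family (active J r c p) r"
    and norec: "\<And>w. \<forall>j\<in>J. r j \<bullet> w \<le> 0 \<Longrightarrow> \<forall>j\<in>E. r j \<bullet> w = 0 \<Longrightarrow> w = 0"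
  shows "finite {p \<in> feasible_face J r c E. card (active J r c p) = DIM('a)} \<and>
    even (card {p \<in> feasible_face J r c E. card (active J r c p) = DIM('a)})"
proof (cases "feasible_face J r c E = {}")
  case False
  let ?F = "feasible_face J r c E" and ?A = "active J r c"
  have finE: "finite E"
    using E J finite_subset by blast
  obtain p0 where p0: "p0 \<in> ?F"
    using False by blast
  have indE: "independent_family E r"
    using independent_family_subset[OF indep[OF p0]] p0 finite_active[OF J]
    by (auto simp: feasible_face_def)
  obtain w where w: "w \<noteq> 0" "\<And>j. j \<in> E \<Longrightarrow> r j \<bullet> w = 0"
    using orthogonal_nonzero_exists[OF finE, of r] E(2) by auto
  have line: "\<exists>s. q = p + s *\<^sub>R w" if "p \<in> ?F" "q \<in> ?F" for p q
  proof -
    have "r j \<bullet> (q - p) = 0" if "j \<in> E" for j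
      using \<open>p \<in> ?F\<close> \<open>q \<in> ?F\<close> that by (force simp: feasible_face_def active_def inner_diff_right)
    then obtain s where "q - p = s *\<^sub>R w"
      using orthogonal_line[OF finE indE E(2) w] by metis
    then show ?thesis
      by (metis add.commute diff_add_cancel)
  qed
  have upper: "\<exists>M. \<forall>s. p0 + s *\<^sub>R v \<in> ?F \<longrightarrow> s \<le> M"
    if v: "v \<noteq> 0" "\<And>j. j \<in> E \<Longrightarrow> r j \<bullet> v = 0" for v
  proof -
    obtain j where j: "j \<in> J" "r j \<bullet> v > 0"
      using norec[of v] v by force
    have "s \<le> - (r j \<bullet> p0 + c j) / (r j \<bullet> v)" if "p0 + s *\<^sub>R v \<in> ?F" for s
    proof -
      have "r j \<bullet> (p0 + s *\<^sub>R v) + c j \<le> 0"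
        using that j(1) by (auto simp: feasible_face_def feasible_def)
      then show ?thesis
        using j(2) by (simp add: field_simps inner_add_right)
    qed
    then show ?thesis
      by blast
  qed
  obtain M where M: "\<And>s. p0 + s *\<^sub>R w \<in> ?F \<Longrightarrow> s \<le> M"
    using upper[OF w] by blast
  obtain m where m: "\<And>s. p0 + s *\<^sub>R (- w) \<in> ?F \<Longrightarrow> s \<le> m"
    using upper[of "- w"] w by auto
  have "?F \<subseteq> (\<lambda>s. p0 + s *\<^sub>R w) ` {- m..M}"
  proof
    fix q assume q: "q \<in> ?F"
    then obtain s where s: "q = p0 + s *\<^sub>R w"
      using line[OF p0] by blast
    then have "s \<le> M" "- s \<le> m"
      using q M[of s] m[of "- s"] by simp_all
    then show "q \<in> (\<lambda>s. p0 + s *\<^sub>R w) ` {- m..M}"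
      using s by auto
  qed
  moreover have "compact ((\<lambda>s. p0 + s *\<^sub>R w) ` {- m..M})"
    by (intro compact_continuous_image continuous_intros) auto
  ultimately have "compact ?F"
    using closed_feasible_face compact_Int_closed by (metis inf.absorb_iff2)
  moreover have "collinear ?F"
    unfolding collinear_alt using line[OF p0] by blast
  ultimately obtain a b where ab: "?F = closed_segment a b"
    using compact_convex_collinear_segment[OF False _ convex_feasible_face] by blast
  \<comment> \<open>Independence allows at most \<open>DIM('a)\<close> tight constraints and
    \<open>E\<close> accounts for all but one of them. A further one is transverse to
    \<open>w\<close>, since nothing nonzero is orthogonal to a basis.\<close>
  have act: "?A p = E \<or> (\<exists>j. j \<notin> E \<and> ?A p = insert j E \<and> r j \<bullet> w \<noteq> 0 \<and> card (?A p) = DIM('a))"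
    if p: "p \<in> ?F" for p
  proof (cases "?A p = E")
    case False
    moreover have sub: "E \<subseteq> ?A p"
      using p by (simp add: feasible_face_def)
    ultimately obtain j where j: "j \<in> ?A p" "j \<notin> E"
      by blast
    have le: "card (?A p) \<le> DIM('a)"
      using independent_family_card_le[OF finite_active[OF J] indep[OF p]] .
    have "insert j E \<subseteq> ?A p" "card (insert j E) = DIM('a)"
      using j sub finE E(2) by auto
    then have eq: "?A p = insert j E"
      using le by (metis card_seteq finite_active[OF J])
    then have card: "card (?A p) = DIM('a)"
      using \<open>card (insert j E) = DIM('a)\<close> by simp
    have "r j \<bullet> w \<noteq> 0"
      using independent_family_orthogonal_zero[OF finite_active[OF J] indep[OF p] card, of w] w eq
      by auto
    then show ?thesis
      using j eq card by blast
  qed simp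
  \<comment> \<open>This excludes a segment shrunk to one point: at most one constraint beyond
    \<open>E\<close> is tight at \<open>p\<close>, and one of \<open>w\<close>, \<open>- w\<close>
    respects it.\<close>
  have other: "\<exists>q\<in>?F. q \<noteq> p" if p: "p \<in> ?F" for p
  proof -
    obtain v where v: "v \<noteq> 0" "\<And>j. j \<in> E \<Longrightarrow> r j \<bullet> v = 0" "\<And>j. j \<in> ?A p \<Longrightarrow> r j \<bullet> v \<le> 0"
    proof -
      consider "\<forall>j\<in>?A p. r j \<bullet> w \<le> 0" | "\<forall>j\<in>?A p. r j \<bullet> (- w) \<le> 0"
        using act[OF p] w(2) by fastforce
      then show thesis
        using that[of w] that[of "- w"] w by cases auto
    qed
    obtain e where "e > 0" "p + e *\<^sub>R v \<in> ?F"
      using feasible_face_move[OF J p v(3,2)] by blast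
    then show ?thesis
      using v(1) by (intro bexI[of _ "p + e *\<^sub>R v"]) auto
  qed
  have ext: "p extreme_point_of ?F \<longleftrightarrow> card (?A p) = DIM('a)" if p: "p \<in> ?F" for p
  proof
    assume *: "p extreme_point_of ?F"
    have "?A p \<noteq> E"
    proof
      assume AE: "?A p = E"
      obtain e where e: "e > 0" "p + e *\<^sub>R w \<in> ?F"
        using feasible_face_move[OF J p, of w] AE w(2) by auto
      obtain e' where e': "e' > 0" "p + e' *\<^sub>R (- w) \<in> ?F"
        using feasible_face_move[OF J p, of "- w"] AE w(2) by auto
      \<comment> \<open>The weight at which the step \<open>e\<close> forward and the step
        \<open>e'\<close> backward average to \<open>p\<close>.\<close>
      define q where "q = e' / (e + e')"
      have "(1 - q) *\<^sub>R (p + e' *\<^sub>R (- w)) + q *\<^sub>R (p + e *\<^sub>R w) = p + (q * e - (1 - q) * e') *\<^sub>R w"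
        by (simp add: algebra_simps)
      moreover have "q * e - (1 - q) * e' = 0"
        using e e' by (simp add: q_def field_simps)
      ultimately have "p = (1 - q) *\<^sub>R (p + e' *\<^sub>R (- w)) + q *\<^sub>R (p + e *\<^sub>R w)"
        by simp
      moreover have "0 < q" "q < 1"
        using e e' by (simp_all add: q_def field_simps)
      moreover have "p + e' *\<^sub>R (- w) \<noteq> p + e *\<^sub>R w"
      proof
        assume "p + e' *\<^sub>R (- w) = p + e *\<^sub>R w"
        moreover have "(e + e') *\<^sub>R w = (p + e *\<^sub>R w) - (p + e' *\<^sub>R (- w))"
          by (simp add: scaleR_add_left)
        ultimately have "(e + e') *\<^sub>R w = 0"
          by simp
        then show False
          using e e' w(1) by simp
      qed
      ultimately have "p \<in> open_segment (p + e' *\<^sub>R (- w)) (p + e *\<^sub>R w)"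
        unfolding in_segment by blast
      then show False
        using * e e' unfolding extreme_point_of_def by blast
    qed
    then show "card (?A p) = DIM('a)"
      using act[OF p] by blast
  next
    assume card: "card (?A p) = DIM('a)"
    then have "?A p \<noteq> E"
      using E(2) by auto
    then obtain j where j: "?A p = insert j E" "r j \<bullet> w \<noteq> 0"
      using act[OF p] by blast
    have jJ: "j \<in> J" "r j \<bullet> p + c j = 0"
      using j(1) by (auto simp: active_def set_eq_iff)
    have "p \<notin> open_segment x y" if xy: "x \<in> ?F" "y \<in> ?F" for x y
    proof
      assume "p \<in> open_segment x y"
      then obtain u where u: "x \<noteq> y" "0 < u" "u < 1" "p = (1 - u) *\<^sub>R x + u *\<^sub>R y"
        unfolding in_segment by blast
      have le: "r j \<bullet> x + c j \<le> 0" "r j \<bullet> y + c j \<le> 0"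
        using xy jJ(1) by (auto simp: feasible_face_def feasible_def)
      have "(1 - u) * (r j \<bullet> x + c j) + u * (r j \<bullet> y + c j) = 0"
        using jJ(2) u(4) by (simp add: inner_add_right algebra_simps)
      moreover have "(1 - u) * (r j \<bullet> x + c j) \<le> 0" "u * (r j \<bullet> y + c j) \<le> 0"
        using le u by (simp_all add: mult_nonneg_nonpos)
      ultimately have "(1 - u) * (r j \<bullet> x + c j) = 0" "u * (r j \<bullet> y + c j) = 0"
        by linarith+
      then have z: "r j \<bullet> x + c j = 0" "r j \<bullet> y + c j = 0"
        using u by simp_all
      obtain s where s: "y = x + s *\<^sub>R w"
        using line[OF xy] by blast
      then have "s * (r j \<bullet> w) = (r j \<bullet> y + c j) - (r j \<bullet> x + c j)"
        by (simp add: inner_add_right)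
      then have "s * (r j \<bullet> w) = 0"
        using z by simp
      then show False
        using s j(2) u(1) by simp
    qed
    then show "p extreme_point_of ?F"
      using p by (simp add: extreme_point_of_def)
  qed
  have "{p \<in> ?F. card (?A p) = DIM('a)} = {a, b}"
    using ext unfolding ab extreme_point_of_segment by auto
  moreover have "a \<noteq> b"
    using other[of a] ab by auto
  ultimately show ?thesis
    by simp
qed simp

lemma of_nat_bit_even: "even n \<Longrightarrow> of_nat n = (0::bit)"
  by (metis dvdE mult_zero_left of_nat_mult of_nat_numeral bit_2_eq_0)

text \<open>The faces of nonzero weight are the edges of a finite graph, each with two ends.\<close>

lemma weighted_edges_handshake:
  fixes r :: "'j \<Rightarrow> 'a::euclidean_space" and g :: "'j set \<Rightarrow> bit"
  assumes J: "finite J"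
    and indep: "\<And>E p. E \<subseteq> J \<Longrightarrow> card E + 1 = DIM('a) \<Longrightarrow> g E \<noteq> 0 \<Longrightarrow> p \<in> feasible_face J r c E \<Longrightarrow>
      independent_family (active J r c p) r"
    and norec: "\<And>E w. E \<subseteq> J \<Longrightarrow> card E + 1 = DIM('a) \<Longrightarrow> g E \<noteq> 0 \<Longrightarrow>
      \<forall>j\<in>J. r j \<bullet> w \<le> 0 \<Longrightarrow> \<forall>j\<in>E. r j \<bullet> w = 0 \<Longrightarrow> w = 0"
  defines "V \<equiv> {p \<in> feasible J r c. card (active J r c p) = DIM('a) \<and>
    (\<exists>j\<in>active J r c p. g (active J r c p - {j}) \<noteq> 0)}"
  shows "finite V" and "(\<Sum>p\<in>V. \<Sum>j\<in>active J r c p. g (active J r c p - {j})) = 0"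
proof -
  let ?A = "active J r c"
  define \<E> where "\<E> = {E. E \<subseteq> J \<and> card E + 1 = DIM('a) \<and> g E \<noteq> 0}"
  have fin\<E>: "finite \<E>"
    unfolding \<E>_def using J by (auto intro: finite_subset[of _ "Pow J"])
  have AJ: "?A p \<subseteq> J" for p
    by (auto simp: active_def)
  have finA: "finite (?A p)" for p
    using finite_active[OF J] .
  have ends: "finite {p \<in> feasible_face J r c E. card (?A p) = DIM('a)} \<and>
      even (card {p \<in> feasible_face J r c E. card (?A p) = DIM('a)})" if "E \<in> \<E>" for E
  proof -
    have E: "E \<subseteq> J" "card E + 1 = DIM('a)" "g E \<noteq> 0"
      using that unfolding \<E>_def by blast+
    show ?thesis
      using even_card_face_vertices[OF J E(1,2) indep[OF E] norec[OF E]] .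
  qed
  have minus: "?A p - {j} \<in> \<E>" if "card (?A p) = DIM('a)" "j \<in> ?A p" "g (?A p - {j}) \<noteq> 0" for p j
  proof -
    have "card (?A p - {j}) + 1 = DIM('a)"
      using that(1,2) finA by (metis Suc_eq_plus1 card_Suc_Diff1)
    then show ?thesis
      using that(3) AJ unfolding \<E>_def by blast
  qed
  have V_edge: "{p \<in> V. E \<subseteq> ?A p} = {p \<in> feasible_face J r c E. card (?A p) = DIM('a)}"
    if "E \<in> \<E>" for E
  proof -
    have "\<exists>j\<in>?A p. g (?A p - {j}) \<noteq> 0" if "E \<subseteq> ?A p" "card (?A p) = DIM('a)" for p
    proof -
      have E: "card E + 1 = DIM('a)" "g E \<noteq> 0"
        using \<open>E \<in> \<E>\<close> unfolding \<E>_def by blast+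
      then have "card (?A p - E) = 1"
        using that finA by (simp add: card_Diff_subset finite_subset[OF that(1)])
      then obtain j where "?A p - E = {j}"
        by (auto simp: card_1_singleton_iff)
      then have "j \<in> ?A p" "?A p - {j} = E"
        using that(1) by blast+
      then show ?thesis
        using E(2) by blast
    qed
    then show ?thesis
      unfolding V_def feasible_face_def by blast
  qed
  \<comment> \<open>The nonzero deletion demanded in \<open>V\<close> places each point of
    \<open>V\<close> at an end of one of the finitely many edges in \<open>\<E>\<close>; finiteness
    is known only edge by edge.\<close>
  have "V \<subseteq> (\<Union>E\<in>\<E>. {p \<in> V. E \<subseteq> ?A p})"
  proof
    fix p assume p: "p \<in> V"
    then obtain j where "j \<in> ?A p" "g (?A p - {j}) \<noteq> 0" "card (?A p) = DIM('a)"
      unfolding V_def by blast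
    then have "?A p - {j} \<in> \<E>"
      using minus by blast
    then show "p \<in> (\<Union>E\<in>\<E>. {p \<in> V. E \<subseteq> ?A p})"
      using p by blast
  qed
  moreover have "finite (\<Union>E\<in>\<E>. {p \<in> V. E \<subseteq> ?A p})"
    using fin\<E> ends V_edge by auto
  ultimately show finV: "finite V"
    by (rule finite_subset)
  have inner: "(\<Sum>j\<in>?A p. g (?A p - {j})) = (\<Sum>E\<in>{E \<in> \<E>. E \<subseteq> ?A p}. g E)" if "p \<in> V" for p
  proof -
    have card: "card (?A p) = DIM('a)"
      using that unfolding V_def by blast
    have inj: "inj_on (\<lambda>j. ?A p - {j}) (?A p)"
      by (rule inj_onI) blast
    have "(\<Sum>j\<in>?A p. g (?A p - {j})) = (\<Sum>E\<in>(\<lambda>j. ?A p - {j}) ` ?A p. g E)"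
      using inj by (simp add: sum.reindex)
    also have "\<dots> = (\<Sum>E\<in>{E \<in> \<E>. E \<subseteq> ?A p}. g E)"
    proof (rule sum.mono_neutral_right)
      show "finite ((\<lambda>j. ?A p - {j}) ` ?A p)"
        using finA by simp
      show "{E \<in> \<E>. E \<subseteq> ?A p} \<subseteq> (\<lambda>j. ?A p - {j}) ` ?A p"
      proof
        fix E assume "E \<in> {E \<in> \<E>. E \<subseteq> ?A p}"
        then have E: "E \<subseteq> ?A p" "card E + 1 = DIM('a)"
          unfolding \<E>_def by blast+
        then have "card (?A p - E) = 1"
          using card finA by (simp add: card_Diff_subset finite_subset[OF E(1)])
        then obtain j where "?A p - E = {j}"
          by (auto simp: card_1_singleton_iff)
        then have "j \<in> ?A p" "E = ?A p - {j}"
          using E(1) by blast+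
        then show "E \<in> (\<lambda>j. ?A p - {j}) ` ?A p"
          by blast
      qed
      show "\<forall>E\<in>(\<lambda>j. ?A p - {j}) ` ?A p - {E \<in> \<E>. E \<subseteq> ?A p}. g E = 0"
        using minus[OF card] by blast
    qed
    finally show ?thesis .
  qed
  \<comment> \<open>Double counting of incident pairs of a vertex and an edge: deleting one tight
    constraint at a vertex gives an edge there, and each edge contributes \<open>g E\<close> an even
    number of times.\<close>
  have "(\<Sum>p\<in>V. \<Sum>j\<in>?A p. g (?A p - {j})) = (\<Sum>p\<in>V. \<Sum>E\<in>{E \<in> \<E>. E \<subseteq> ?A p}. g E)"
    using inner by simp
  also have "\<dots> = (\<Sum>E\<in>\<E>. \<Sum>p\<in>{p \<in> V. E \<subseteq> ?A p}. g E)"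
    using finV fin\<E> by (rule sum.swap_restrict)
  also have "\<dots> = (\<Sum>E\<in>\<E>. 0)"
  proof (rule sum.cong)
    fix E assume "E \<in> \<E>"
    then have "even (card {p \<in> V. E \<subseteq> ?A p})"
      using ends V_edge by simp
    then show "(\<Sum>p\<in>{p \<in> V. E \<subseteq> ?A p}. g E) = 0"
      unfolding sum_constant by (simp only: of_nat_bit_even mult_zero_left)
  qed simp
  finally show "(\<Sum>p\<in>V. \<Sum>j\<in>?A p. g (?A p - {j})) = 0"
    by simp
qed

section \<open>Generic coefficients\<close>

text \<open>In the induction step \<open>d\<close> moves in the direction \<open>f\<close> itself,
  along which the value of \<open>f\<close> has slope \<open>\<Sum>j\<in>J. f j * f j > 0\<close>.
  Each of the functionals then vanishes for at most one parameter \<open>s\<close>.\<close>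

lemma avoid_hyperplanes:
  fixes F :: "('j \<Rightarrow> real) set"
  assumes "finite J" "finite F" "\<And>f. f \<in> F \<Longrightarrow> \<exists>j\<in>J. f j \<noteq> 0"
  shows "\<exists>d. \<forall>f\<in>F. (\<Sum>j\<in>J. f j * d j) \<noteq> 0"
  using assms(2,3)
proof (induction F rule: finite_induct)
  case (insert f F)
  then obtain d where d: "\<And>h. h \<in> F \<Longrightarrow> (\<Sum>j\<in>J. h j * d j) \<noteq> 0"
    by auto
  let ?p = "\<lambda>h e. \<Sum>j\<in>J. h j * e j"
  have lin: "?p h (\<lambda>j. d j + s * f j) = ?p h d + s * ?p h f" for h s
    by (simp add: algebra_simps sum.distrib sum_distrib_left)
  have "finite {s. ?p h (\<lambda>j. d j + s * f j) = 0}" if "h \<in> insert f F" for h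
  proof (cases "?p h f = 0")
    case True
    have "?p f f > 0"
      using insert.prems[of f] assms(1) by (auto intro!: sum_pos2 simp: zero_less_mult_iff)
    then have "h \<in> F"
      using that True by auto
    then show ?thesis
      unfolding lin using d True by simp
  next
    case False
    then have "{s. ?p h d + s * ?p h f = 0} \<subseteq> {- ?p h d / ?p h f}"
      by (auto simp: field_simps)
    then show ?thesis
      unfolding lin by (rule finite_subset) simp
  qed
  then have "finite (\<Union>h\<in>insert f F. {s. ?p h (\<lambda>j. d j + s * f j) = 0})"
    using insert.hyps by blast
  then obtain s where "s \<notin> (\<Union>h\<in>insert f F. {s. ?p h (\<lambda>j. d j + s * f j) = 0})"
    using ex_new_if_finite infinite_UNIV_char_0 by blast
  then have "\<forall>h\<in>insert f F. ?p h (\<lambda>j. d j + s * f j) \<noteq> 0"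
    by simp
  then show ?case
    by (intro exI[of _ "\<lambda>j. d j + s * f j"])
qed simp

definition relation_on :: "'j set \<Rightarrow> ('j \<Rightarrow> 'b::real_vector) \<Rightarrow> ('j \<Rightarrow> real) \<Rightarrow> bool"
  where "relation_on S \<alpha> \<mu> \<longleftrightarrow> (\<Sum>j\<in>S. \<mu> j *\<^sub>R \<alpha> j) = 0"

text \<open>The premises are the compatibility condition for
  \<open>\<alpha> j \<bullet> z + e j = 0\<close> on \<open>S\<close>, namely that every relation
  among the \<open>\<alpha> j\<close> annihilates the constants, at \<open>d\<close> itself and at a
  time strictly between. The second conclusion says that the vectors
  \<open>(\<alpha> j, d j)\<close> are independent: relations among the \<open>\<alpha> j\<close>
  may exist, but only \<open>d\<close> may break them. Time 0 is left to transversality.\<close>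

definition generic_towards ::
    "'j set \<Rightarrow> ('j \<Rightarrow> 'b::real_vector) \<Rightarrow> ('j \<Rightarrow> real) \<Rightarrow> ('j \<Rightarrow> real) \<Rightarrow> bool"
  where "generic_towards S \<alpha> c d \<longleftrightarrow>
    ((\<forall>\<mu>. relation_on S \<alpha> \<mu> \<longrightarrow> (\<Sum>j\<in>S. \<mu> j * d j) = 0) \<longrightarrow> independent_family S \<alpha>) \<and>
    (\<forall>t. 0 < t \<and> t < 1 \<and>
        (\<forall>\<mu>. relation_on S \<alpha> \<mu> \<longrightarrow> (\<Sum>j\<in>S. \<mu> j * ((1 - t) * c j + t * d j)) = 0) \<longrightarrow>
      (\<forall>\<mu>. relation_on S \<alpha> \<mu> \<and> (\<Sum>j\<in>S. \<mu> j * d j) = 0 \<longrightarrow> (\<forall>j\<in>S. \<mu> j = 0)))"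

text \<open>If the relations on \<open>S\<close> span at least two dimensions, the values \<open>t\<close> excluded by two of them,
  \<open>\<mu>\<close> and \<open>\<nu>\<close>, coincide only if \<open>d\<close> annihilates \<open>\<langle>\<mu>, c\<rangle> \<nu> - \<langle>\<nu>, c\<rangle> \<mu>\<close>.\<close>

lemma generic_towards_off_hyperplanes:
  fixes \<alpha> :: "'j \<Rightarrow> 'b::real_vector"
  assumes "finite S"
  obtains F where "finite F" "\<And>f. f \<in> F \<Longrightarrow> \<exists>j\<in>S. f j \<noteq> 0"
    "\<And>d. \<forall>f\<in>F. (\<Sum>j\<in>S. f j * d j) \<noteq> 0 \<Longrightarrow> generic_towards S \<alpha> c d"
proof (cases "independent_family S \<alpha>")
  case True
  then have "generic_towards S \<alpha> c d" for d
    by (auto simp: generic_towards_def independent_family_def relation_on_def)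
  then show thesis
    by (intro that[of "{}"]) auto
next
  case False
  let ?p = "\<lambda>h e. \<Sum>j\<in>S. h j * e j"
  obtain \<mu> where \<mu>: "relation_on S \<alpha> \<mu>" "\<exists>j\<in>S. \<mu> j \<noteq> 0"
    using False by (auto simp: independent_family_def relation_on_def)
  show thesis
  proof (cases "\<forall>\<nu>. relation_on S \<alpha> \<nu> \<longrightarrow> (\<exists>a. \<forall>j\<in>S. \<nu> j = a * \<mu> j)")
    case True
    \<comment> \<open>For a one-dimensional space of relations, a \<open>d\<close> off the
      hyperplane of \<open>\<mu>\<close> refutes the first premise and, every relation being a
      multiple of \<open>\<mu>\<close>, yields the second conclusion.\<close>
    show thesis
    proof (rule that[of "{\<mu>}"])
      fix d assume d: "\<forall>f\<in>{\<mu>}. ?p f d \<noteq> 0"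
      have "\<forall>j\<in>S. \<nu> j = 0" if \<nu>: "relation_on S \<alpha> \<nu>" "?p \<nu> d = 0" for \<nu>
      proof -
        obtain a where a: "\<And>j. j \<in> S \<Longrightarrow> \<nu> j = a * \<mu> j"
          using True \<nu>(1) by blast
        then have "?p \<nu> d = a * ?p \<mu> d"
          unfolding sum_distrib_left by (intro sum.cong) auto
        then show ?thesis
          using a \<nu>(2) d by simp
      qed
      then show "generic_towards S \<alpha> c d"
        using \<mu>(1) d by (auto simp: generic_towards_def)
    qed (use \<mu>(2) in auto)
  next
    case False
    then obtain \<nu> where \<nu>: "relation_on S \<alpha> \<nu>" "\<And>a. \<exists>j\<in>S. \<nu> j \<noteq> a * \<mu> j"
      by blast
    define \<kappa> where "\<kappa> = (\<lambda>j. ?p \<mu> c * \<nu> j - ?p \<nu> c * \<mu> j)"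
    \<comment> \<open>\<open>\<kappa>\<close> can vanish on \<open>S\<close> only if
      \<open>c\<close> annihilates \<open>\<mu>\<close>, as \<open>\<nu>\<close> is no multiple of
      \<open>\<mu>\<close>. In that case the equation of \<open>\<mu>\<close> at time
      \<open>t\<close> already contradicts that \<open>d\<close> does not annihilate
      \<open>\<mu>\<close>.\<close>
    define F where "F = (if \<exists>j\<in>S. \<kappa> j \<noteq> 0 then {\<mu>, \<kappa>} else {\<mu>})"
    show thesis
    proof (rule that[of F])
      show "finite F"
        by (simp add: F_def)
      show "\<exists>j\<in>S. f j \<noteq> 0" if "f \<in> F" for f
        using that \<mu>(2) by (auto simp: F_def split: if_splits)
      fix d assume d: "\<forall>f\<in>F. ?p f d \<noteq> 0"
      then have \<mu>d: "?p \<mu> d \<noteq> 0"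
        by (auto simp: F_def split: if_splits)
      have False if t: "0 < t" "t < 1"
        and rel: "\<And>\<mu>. relation_on S \<alpha> \<mu> \<Longrightarrow> ?p \<mu> (\<lambda>j. (1 - t) * c j + t * d j) = 0" for t
      proof -
        have eq: "(1 - t) * ?p \<rho> c = - t * ?p \<rho> d" if "relation_on S \<alpha> \<rho>" for \<rho>
        proof -
          have "(1 - t) * ?p \<rho> c + t * ?p \<rho> d = ?p \<rho> (\<lambda>j. (1 - t) * c j + t * d j)"
            unfolding sum_distrib_left sum.distrib[symmetric]
            by (intro sum.cong) (simp_all add: algebra_simps)
          then show ?thesis
            using rel[OF that] by simp
        qed
        have "(1 - t) * ?p \<mu> c \<noteq> 0"
          using eq[OF \<mu>(1)] \<mu>d t by simp
        then have \<mu>c: "?p \<mu> c \<noteq> 0"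
          by auto
        have "\<exists>j\<in>S. \<kappa> j \<noteq> 0"
        proof -
          obtain j where "j \<in> S" "\<nu> j \<noteq> (?p \<nu> c / ?p \<mu> c) * \<mu> j"
            using \<nu>(2) by blast
          then show ?thesis
            using \<mu>c by (intro bexI[of _ j]) (auto simp: \<kappa>_def field_simps)
        qed
        then have "?p \<kappa> d \<noteq> 0"
          using d by (simp add: F_def)
        moreover have "?p \<kappa> d = ?p \<mu> c * ?p \<nu> d - ?p \<nu> c * ?p \<mu> d"
        proof -
          have "?p \<kappa> d = (\<Sum>j\<in>S. ?p \<mu> c * (\<nu> j * d j) - ?p \<nu> c * (\<mu> j * d j))"
            by (intro sum.cong) (simp_all add: \<kappa>_def algebra_simps)
          then show ?thesis
            by (simp only: sum_subtractf sum_distrib_left[symmetric])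
        qed
        \<comment> \<open>After multiplication by \<open>1 - t\<close>, both products turn into
          \<open>- t * ?p \<mu> d * ?p \<nu> d\<close> and cancel.\<close>
        moreover have "(1 - t) * (?p \<mu> c * ?p \<nu> d - ?p \<nu> c * ?p \<mu> d)
            = ((1 - t) * ?p \<mu> c) * ?p \<nu> d - ((1 - t) * ?p \<nu> c) * ?p \<mu> d"
          by (simp only: right_diff_distrib mult.assoc)
        ultimately show False
          using t(2) unfolding eq[OF \<mu>(1)] eq[OF \<nu>(1)] by simp
      qed
      then show "generic_towards S \<alpha> c d"
        using \<mu>(1) \<mu>d unfolding generic_towards_def by meson
    qed
  qed
qed

text \<open>Each of the finitely many pairs of a subset \<open>S\<close> and a starting point in
  \<open>C\<close> excludes finitely many hyperplanes, so one \<open>d\<close> serves them all.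
  \<open>C\<close> will consist of the two given coefficient systems.\<close>

lemma generic_towards_exists:
  fixes \<alpha> :: "'j \<Rightarrow> 'b::real_vector"
  assumes "finite J" "finite C"
  obtains d where "\<And>S c. S \<subseteq> J \<Longrightarrow> c \<in> C \<Longrightarrow> generic_towards S \<alpha> c d"
proof -
  define Q where "Q S c F \<longleftrightarrow> finite F \<and> (\<forall>f\<in>F. \<exists>j\<in>S. f j \<noteq> 0) \<and>
      (\<forall>d. (\<forall>f\<in>F. (\<Sum>j\<in>S. f j * d j) \<noteq> 0) \<longrightarrow> generic_towards S \<alpha> c d)" for S c F
  define F where "F S c = (SOME F. Q S c F)" for S c
  have Q: "Q S c (F S c)" if S: "S \<subseteq> J" for S c
  proof -
    obtain F' where "finite F'" "\<And>f. f \<in> F' \<Longrightarrow> \<exists>j\<in>S. f j \<noteq> 0"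
        "\<And>d. \<forall>f\<in>F'. (\<Sum>j\<in>S. f j * d j) \<noteq> 0 \<Longrightarrow> generic_towards S \<alpha> c d"
      using generic_towards_off_hyperplanes[OF finite_subset[OF S assms(1)], of \<alpha> c] by blast
    then have "Q S c F'"
      unfolding Q_def by blast
    then show ?thesis
      unfolding F_def by (rule someI)
  qed
  have F: "finite (F S c)" "f \<in> F S c \<Longrightarrow> \<exists>j\<in>S. f j \<noteq> 0"
      "\<forall>f\<in>F S c. (\<Sum>j\<in>S. f j * d j) \<noteq> 0 \<Longrightarrow> generic_towards S \<alpha> c d" if "S \<subseteq> J" for S c f d
    using Q[OF that, of c] unfolding Q_def by simp_all
  define ext where "ext S f = (\<lambda>j. if j \<in> S then f j else 0)" for S and f :: "'j \<Rightarrow> real"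
  define G where "G = (\<Union>S\<in>Pow J. \<Union>c\<in>C. ext S ` F S c)"
  have "finite G"
    unfolding G_def using assms F(1) by auto
  moreover have "\<forall>f\<in>G. \<exists>j\<in>J. f j \<noteq> 0"
    unfolding G_def ball_UN Set.ball_simps(9)
  proof (intro ballI)
    fix S c f assume "S \<in> Pow J" "f \<in> F S c"
    then obtain j where "j \<in> S" "j \<in> J" "f j \<noteq> 0"
      using F(2)[of S f c] by auto
    then show "\<exists>j\<in>J. ext S f j \<noteq> 0"
      by (intro bexI[of _ j]) (auto simp: ext_def)
  qed
  ultimately obtain d where d: "\<And>f. f \<in> G \<Longrightarrow> (\<Sum>j\<in>J. f j * d j) \<noteq> 0"
    using avoid_hyperplanes[OF assms(1), of G] by auto
  show thesis
  proof (rule that)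
    fix S c assume S: "S \<subseteq> J" and c: "c \<in> C"
    have "(\<Sum>j\<in>S. f j * d j) \<noteq> 0" if "f \<in> F S c" for f
    proof -
      have "(\<Sum>j\<in>J. ext S f j * d j) = (\<Sum>j\<in>S. f j * d j)"
        using assms(1) S by (intro sum.mono_neutral_cong_right) (auto simp: ext_def)
      moreover have "ext S f \<in> G"
        unfolding G_def using S c that by (intro UN_I[of S] UN_I[of c] imageI) simp_all
      ultimately show ?thesis
        using d by metis
    qed
    then show "generic_towards S \<alpha> c d"
      by (intro F(3)[OF S] ballI)
  qed
qed

text \<open>Solvability implies the compatibility condition on which \<open>generic_towards\<close>
  is built.\<close>

lemma relation_on_solution:
  fixes \<alpha> :: "'j \<Rightarrow> 'b::real_inner"
  assumes "relation_on S \<alpha> \<mu>" "\<And>j. j \<in> S \<Longrightarrow> \<alpha> j \<bullet> z + c j = 0"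
  shows "(\<Sum>j\<in>S. \<mu> j * c j) = 0"
proof -
  have "(\<Sum>j\<in>S. \<mu> j * c j) = (\<Sum>j\<in>S. - (\<mu> j *\<^sub>R \<alpha> j) \<bullet> z)"
  proof (rule sum.cong)
    fix j assume "j \<in> S"
    then have "c j = - (\<alpha> j \<bullet> z)"
      using assms(2)[of j] by simp
    then show "\<mu> j * c j = - (\<mu> j *\<^sub>R \<alpha> j) \<bullet> z"
      by simp
  qed simp
  also have "\<dots> = - (\<Sum>j\<in>S. \<mu> j *\<^sub>R \<alpha> j) \<bullet> z"
    by (simp add: inner_sum_left sum_negf)
  finally show ?thesis
    using assms(1) by (simp add: relation_on_def)
qed

lemma generic_towards_end:
  assumes "generic_towards S \<alpha> c d" "\<And>j. j \<in> S \<Longrightarrow> \<alpha> j \<bullet> z + d j = 0"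
  shows "independent_family S \<alpha>"
  using assms(1) relation_on_solution[where S = S and \<alpha> = \<alpha> and z = z, OF _ assms(2)]
  unfolding generic_towards_def by blast

text \<open>The extra coordinate \<open>d j - c j\<close> is the slope in \<open>t\<close> of the
  interpolated constant, so these vectors are the normals of the constraints in the variables
  \<open>(z, t)\<close>.\<close>

lemma generic_towards_inside:
  fixes \<alpha> :: "'j \<Rightarrow> 'b::real_inner"
  assumes "generic_towards S \<alpha> c d" "0 < t" "t < 1"
    and sol: "\<And>j. j \<in> S \<Longrightarrow> \<alpha> j \<bullet> z + ((1 - t) * c j + t * d j) = 0"
  shows "independent_family S (\<lambda>j. (\<alpha> j, d j - c j))"
  unfolding independent_family_def
proof (intro allI impI)
  fix \<mu> assume "(\<Sum>j\<in>S. \<mu> j *\<^sub>R (\<alpha> j, d j - c j)) = 0"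
  then have rel: "relation_on S \<alpha> \<mu>" and diff: "(\<Sum>j\<in>S. \<mu> j * (d j - c j)) = 0"
    by (simp_all add: relation_on_def prod_eq_iff fst_sum snd_sum)
  have "(\<Sum>j\<in>S. \<mu> j * ((1 - t) * c j + t * d j)) = 0"
    using relation_on_solution[OF rel sol] .
  \<comment> \<open>\<open>d\<close> is the constant at time \<open>t\<close> plus
    \<open>1 - t\<close> times the slope, and \<open>\<mu>\<close> annihilates both.\<close>
  moreover have "(\<Sum>j\<in>S. \<mu> j * d j)
      = (\<Sum>j\<in>S. \<mu> j * ((1 - t) * c j + t * d j)) + (1 - t) * (\<Sum>j\<in>S. \<mu> j * (d j - c j))"
    unfolding sum_distrib_left sum.distrib[symmetric] by (intro sum.cong) (simp_all add: algebra_simps)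
  ultimately have zero: "(\<Sum>j\<in>S. \<mu> j * d j) = 0"
    using diff by simp
  have all: "\<forall>\<mu>. relation_on S \<alpha> \<mu> \<longrightarrow> (\<Sum>j\<in>S. \<mu> j * ((1 - t) * c j + t * d j)) = 0"
    using relation_on_solution[where S = S and \<alpha> = \<alpha> and z = z, OF _ sol] by blast
  show "\<forall>j\<in>S. \<mu> j = 0"
    by (rule assms(1)[unfolded generic_towards_def, THEN conjunct2, THEN spec[of _ t], THEN mp,
        OF conjI[OF assms(2) conjI[OF assms(3) all]], THEN spec[of _ \<mu>], THEN mp,
        OF conjI[OF rel zero]])
qed

section \<open>Weights of mixed cells\<close>

text \<open>In characteristic 2 the difference of the two endpoints is their sum.\<close>

definition mixed_weight :: "int ^ 'n \<Rightarrow> ('n::finite \<Rightarrow> (int ^ 'n) set) \<Rightarrow> bit"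
  where "mixed_weight \<zeta> F =
    det2 (\<lambda>j. case j of None \<Rightarrow> mod2_vec \<zeta> | Some i \<Rightarrow> \<Sum>a\<in>F i. mod2_vec a)"

lemma sum_mod2_vec_pair:
  assumes "a \<noteq> b"
  shows "(\<Sum>x\<in>{a, b}. mod2_vec x) = mod2_vec (a - b)"
  using assms by (simp add: vec_eq_iff mod2_vec_def)

lemma odd_iff_of_int_bit: "odd k \<longleftrightarrow> (of_int k :: bit) \<noteq> 0"
proof
  assume "odd k"
  then obtain m where "k = 2 * m + 1"
    by (elim oddE)
  then show "(of_int k :: bit) \<noteq> 0"
    by simp
next
  show "odd k" if "(of_int k :: bit) \<noteq> 0"
  proof
    assume "even k"
    then obtain m where "k = 2 * m"
      by (elim evenE)
    then show False
      using that by simp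
  qed
qed

text \<open>One integer determinant is read both over the reals, for Cramer's rule, and modulo 2,
  for its parity.\<close>

lemma det_of_int:
  fixes M :: "int ^ 'n ^ 'n"
  shows "det (\<chi> i j. (of_int (M $ i $ j) :: 'a::comm_ring_1)) = of_int (det M)"
  by (simp add: det_def)

text \<open>Around a triangle the three edge directions add up to 0 modulo 2, because each corner
  occurs twice.\<close>

lemma mixed_weight_three_edges:
  assumes "a \<noteq> b" "b \<noteq> c" "a \<noteq> c"
  shows "mixed_weight \<zeta> (F(i := {b, c})) + mixed_weight \<zeta> (F(i := {a, c})) +
    mixed_weight \<zeta> (F(i := {a, b})) = 0"
proof -
  define k where "k = (\<lambda>j. case j of None \<Rightarrow> mod2_vec \<zeta> | Some i \<Rightarrow> \<Sum>a\<in>F i. mod2_vec a)"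
  have upd: "(\<lambda>j. case j of None \<Rightarrow> mod2_vec \<zeta> | Some j \<Rightarrow> \<Sum>a\<in>(F(i := X)) j. mod2_vec a)
      = k(Some i := \<Sum>a\<in>X. mod2_vec a)" for X
    by (auto simp: k_def fun_eq_iff split: option.splits)
  have "(\<Sum>x\<in>{b, c}. mod2_vec x) + (\<Sum>x\<in>{a, c}. mod2_vec x) + (\<Sum>x\<in>{a, b}. mod2_vec x)
      = (mod2_vec a + mod2_vec a) + (mod2_vec b + mod2_vec b) + (mod2_vec c + mod2_vec c)"
  proof -
    have "(\<Sum>x\<in>{b, c}. mod2_vec x) = mod2_vec b + mod2_vec c"
      "(\<Sum>x\<in>{a, c}. mod2_vec x) = mod2_vec a + mod2_vec c"
      "(\<Sum>x\<in>{a, b}. mod2_vec x) = mod2_vec a + mod2_vec b"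
      using assms by simp_all
    then show ?thesis
      by (simp only: ac_simps)
  qed
  also have "\<dots> = 0"
    by (simp only: bit_vec_add_self add_0)
  finally show ?thesis
    unfolding mixed_weight_def upd by (rule det2_additive)
qed

text \<open>Cramer's rule: the rational line orthogonal to the remaining edge directions is spanned by an
  integer vector \<open>u\<close> whose value at \<open>\<zeta>\<close> is an odd determinant.\<close>

lemma mixed_weight_nonzero_orthogonal:
  fixes F :: "'n::finite \<Rightarrow> (int ^ 'n) set" and v :: "real ^ 'n"
  assumes nz: "mixed_weight \<zeta> F \<noteq> 0" and F: "\<And>i. F i = {p i, q i}" "\<And>i. p i \<noteq> q i"
    and orth: "\<And>i. real_vec (p i) \<bullet> v = real_vec (q i) \<bullet> v"
  obtains u :: "int ^ 'n" and s where "odd (\<Sum>j\<in>UNIV. u $ j * \<zeta> $ j)" "v = s *\<^sub>R real_vec u"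
proof -
  define k where "k = (\<lambda>j. case j of None \<Rightarrow> mod2_vec \<zeta> | Some i \<Rightarrow> \<Sum>a\<in>F i. mod2_vec a)"
  obtain i0 where i0: "vec.span (k ` (- {Some i0})) = UNIV"
    using det2_nonzero_obtain_span[of k] nz unfolding mixed_weight_def k_def by blast
  \<comment> \<open>\<open>\<zeta>\<close> takes the row of the redundant edge direction, so modulo
    2 the rows span the whole space.\<close>
  define M :: "int ^ 'n ^ 'n" where "M = (\<chi> i. if i = i0 then \<zeta> else p i - q i)"
  define R :: "real ^ 'n ^ 'n" where "R = (\<chi> i j. of_int (M $ i $ j))"
  define B :: "bit ^ 'n ^ 'n" where "B = (\<chi> i j. of_int (M $ i $ j))"
  have row_B: "row i B = mod2_vec (M $ i)" for i
    by (simp add: row_def B_def mod2_vec_def vec_eq_iff)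
  have "k ` (- {Some i0}) \<subseteq> rows B"
  proof
    fix x assume "x \<in> k ` (- {Some i0})"
    then obtain j where j: "j \<noteq> Some i0" "x = k j"
      by blast
    show "x \<in> rows B"
    proof (cases j)
      case None
      then have "x = row i0 B"
        using j(2) by (simp add: k_def row_B M_def)
      then show ?thesis
        by (auto simp: rows_def)
    next
      case (Some i)
      then have "x = mod2_vec (p i - q i)"
        using j(2) sum_mod2_vec_pair[OF F(2)] by (simp add: k_def F(1))
      then have "x = row i B"
        using Some j(1) by (simp add: row_B M_def)
      then show ?thesis
        by (auto simp: rows_def)
    qed
  qed
  then have "vec.span (rows B) = UNIV"
    using i0 by (metis top.extremum_uniqueI vec.span_mono)
  then have "invertible B"
    unfolding invertible_left_inverse matrix_left_invertible_span_rows_gen .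
  then have "det B \<noteq> 0"
    by (simp only: invertible_det_nz not_False_eq_True)
  then have odd: "odd (det M)"
    unfolding B_def det_of_int odd_iff_of_int_bit .
  have detR: "det R = of_int (det M)"
    unfolding R_def by (rule det_of_int)
  then have detR0: "det R \<noteq> 0"
    using odd by (metis even_zero of_int_eq_0_iff)
  define e :: "int ^ 'n" where "e = axis i0 1"
  \<comment> \<open>Cramer's numerators for the system \<open>M x = e\<close>: \<open>u\<close> is
    \<open>det M\<close> times the solution, hence integral, orthogonal to every row but
    \<open>i0\<close>, with value \<open>det M\<close> at \<open>\<zeta>\<close>.\<close>
  define u :: "int ^ 'n" where "u = (\<chi> j. det (\<chi> i k. if k = j then e $ i else M $ i $ k))"
  have e_real: "real_vec e = axis i0 1"
    by (simp add: e_def real_vec_def axis_def vec_eq_iff)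
  have "real_of_int (u $ j) = det (\<chi> i k. if k = j then real_vec e $ i else R $ i $ k)" for j
  proof -
    have "real_of_int (u $ j)
        = det (\<chi> i k. real_of_int ((\<chi> i k. if k = j then e $ i else M $ i $ k) $ i $ k))"
      unfolding det_of_int by (simp add: u_def)
    also have "(\<chi> i k. real_of_int ((\<chi> i k. if k = j then e $ i else M $ i $ k) $ i $ k))
        = (\<chi> i k. if k = j then real_vec e $ i else R $ i $ k)"
      by (simp add: vec_eq_iff R_def real_vec_def)
    finally show ?thesis .
  qed
  then have u_div: "(1 / det R) *\<^sub>R real_vec u
      = (\<chi> j. det (\<chi> i k. if k = j then real_vec e $ i else R $ i $ k) / det R)"
    by (simp add: vec_eq_iff real_vec_def)
  have solve: "R *v x = s *\<^sub>R axis i0 1 \<longleftrightarrow> x = (s / det R) *\<^sub>R real_vec u" for x s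
  proof -
    have 1: "R *v ((1 / det R) *\<^sub>R real_vec u) = axis i0 1"
      using cramer[OF detR0, of _ "real_vec e"] u_div e_real by metis
    then have 2: "R *v ((s / det R) *\<^sub>R real_vec u) = s *\<^sub>R axis i0 1"
      by (metis (no_types, opaque_lifting) divide_inverse mult.commute mult.left_neutral
        matrix_vector_mult_scaleR scaleR_scaleR)
    have "inj ((*v) R)"
      using detR0 by (simp add: invertible_det_nz[symmetric] inj_matrix_vector_mult)
    then show ?thesis
      using 2 by (metis injD)
  qed
  have mult: "(R *v x) $ i = real_vec (M $ i) \<bullet> x" for x i
    by (simp add: matrix_vector_mult_def inner_vec_def R_def real_vec_def)
  \<comment> \<open>\<open>v\<close> is orthogonal to all edge directions, so only the row of
    \<open>\<zeta>\<close> contributes; uniqueness of the solution makes \<open>v\<close> a multiple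
    of \<open>u\<close>.\<close>
  have "R *v v = (real_vec \<zeta> \<bullet> v) *\<^sub>R axis i0 1"
  proof -
    have "real_vec (p i - q i) \<bullet> v = 0" for i
      using orth[of i] by (simp add: real_vec_def inner_vec_def algebra_simps sum_subtractf)
    then show ?thesis
      unfolding vec_eq_iff mult by (auto simp: M_def axis_def)
  qed
  then have v: "v = ((real_vec \<zeta> \<bullet> v) / det R) *\<^sub>R real_vec u"
    by (simp add: solve)
  have "R *v real_vec u = det R *\<^sub>R axis i0 1"
    using detR0 by (simp add: solve)
  then have "real_vec \<zeta> \<bullet> real_vec u = det R"
    using mult[of "real_vec u" i0] by (simp add: M_def)
  then have "real_of_int (\<Sum>j\<in>UNIV. u $ j * \<zeta> $ j) = real_of_int (det M)"
    by (simp add: detR inner_vec_def real_vec_def mult.commute)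
  then have "odd (\<Sum>j\<in>UNIV. u $ j * \<zeta> $ j)"
    using odd by (metis of_int_eq_iff)
  then show thesis
    using v by (rule that)
qed

text \<open>A real direction \<open>v\<close> is no covector, but nonzero weight makes it a multiple
  of an integral \<open>u\<close> with odd value at \<open>\<zeta>\<close>. In the polynomial
  \<open>i\<close> supplied by two-developedness, both points of \<open>F i\<close> lie in a
  2-vertex, so they agree modulo 2 and the \<open>i\<close>-th argument of the determinant is
  0.\<close>

lemma two_developed_no_recession:
  fixes P :: "'n::finite \<Rightarrow> (int ^ 'n) set"
  assumes dev: "two_developed P \<zeta>" and nz: "mixed_weight \<zeta> F \<noteq> 0"
    and F: "\<And>i. F i \<subseteq> P i" "\<And>i. card (F i) = 2"
    and le: "\<And>i a. a \<in> P i \<Longrightarrow> real_vec a \<bullet> v \<le> \<eta> i"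
    and eq: "\<And>i a. a \<in> F i \<Longrightarrow> real_vec a \<bullet> v = \<eta> i"
  shows "v = 0"
proof (rule ccontr)
  assume "v \<noteq> 0"
  have "\<forall>i. \<exists>p q. F i = {p, q} \<and> p \<noteq> q"
    using F(2) by (simp add: card_2_iff)
  then obtain p q where pq: "\<And>i. F i = {p i, q i}" "\<And>i. p i \<noteq> q i"
    by metis
  have "real_vec (p i) \<bullet> v = real_vec (q i) \<bullet> v" for i
    using eq[of "p i" i] eq[of "q i" i] pq(1) by simp
  then obtain u s where u: "odd (\<Sum>j\<in>UNIV. u $ j * \<zeta> $ j)" and s: "v = s *\<^sub>R real_vec u"
    using mixed_weight_nonzero_orthogonal[OF nz pq] by metis
  have "s \<noteq> 0"
    using s \<open>v \<noteq> 0\<close> by auto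
  \<comment> \<open>The sign of \<open>s\<close>: it makes \<open>f\<close> a positive multiple of
    \<open>v\<close> and preserves parity.\<close>
  define \<epsilon> :: int where "\<epsilon> = (if s > 0 then 1 else - 1)"
  define f where "f x = \<epsilon> * (\<Sum>j\<in>UNIV. u $ j * x $ j)" for x
  have "Modules.additive f"
    by (simp add: Modules.additive_def f_def algebra_simps sum.distrib)
  moreover have "odd (f \<zeta>)"
    using u by (simp add: f_def \<epsilon>_def)
  ultimately obtain i where i: "two_vertex (support_face (P i) f)"
    using dev unfolding two_developed_def by blast
  have f_real: "real_vec x \<bullet> v = \<bar>s\<bar> * real_of_int (f x)" for x
  proof -
    have "real_vec x \<bullet> v = s * (\<Sum>j\<in>UNIV. real_of_int (u $ j * x $ j))"
      by (simp add: s inner_vec_def real_vec_def sum_distrib_left ac_simps)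
    then show ?thesis
      by (simp add: f_def \<epsilon>_def abs_if)
  qed
  have "f a \<le> f b" if "a \<in> P i" "b \<in> F i" for a b
  proof -
    have "\<bar>s\<bar> * real_of_int (f a) \<le> \<bar>s\<bar> * real_of_int (f b)"
      using le[OF that(1)] eq[OF that(2)] by (simp flip: f_real)
    then show ?thesis
      using \<open>s \<noteq> 0\<close> by simp
  qed
  then have "F i \<subseteq> support_face (P i) f"
    using F(1) by (auto simp: support_face_def)
  then have "[p i $ j = q i $ j] (mod 2)" for j
    using i pq(1)[of i] unfolding two_vertex_def by blast
  then have "even ((p i - q i) $ j)" for j
    by (simp add: cong_iff_dvd_diff)
  then have "of_int ((p i - q i) $ j) = (0 :: bit)" for j
    using odd_iff_of_int_bit by blast
  then have "mod2_vec (p i - q i) = 0"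
    unfolding mod2_vec_def vec_eq_iff vec_lambda_beta zero_index by blast
  then have "(\<Sum>a\<in>F i. mod2_vec a) = 0"
    unfolding pq(1) sum_mod2_vec_pair[OF pq(2)] .
  then have "mixed_weight \<zeta> F = 0"
    unfolding mixed_weight_def by (intro det2_zero_arg[of _ "Some i"]) simp
  with nz show False ..
qed

section \<open>The homotopy\<close>

text \<open>A vector with nonzero coefficient in a relation is dropped, which leaves too few vectors
  to span. Orthogonality to the dropped one is recovered by pairing the relation with
  \<open>w\<close>.\<close>

lemma dependent_family_orthogonal:
  fixes r :: "'j \<Rightarrow> 'a::euclidean_space"
  assumes "finite J" "\<not> independent_family J r" "card J \<le> DIM('a)"
  obtains w where "w \<noteq> 0" "\<And>j. j \<in> J \<Longrightarrow> r j \<bullet> w = 0"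
proof -
  obtain \<mu> j where \<mu>: "(\<Sum>j\<in>J. \<mu> j *\<^sub>R r j) = 0" and j: "j \<in> J" "\<mu> j \<noteq> 0"
    using assms(2) unfolding independent_family_def by blast
  have "card (J - {j}) < DIM('a)"
    using assms(1,3) j(1) by (meson card_Diff1_less order_less_le_trans)
  then obtain w where w: "w \<noteq> 0" "\<And>i. i \<in> J - {j} \<Longrightarrow> r i \<bullet> w = 0"
    using orthogonal_nonzero_exists[of "J - {j}" r] assms(1) by blast
  have "0 = (\<Sum>i\<in>J. \<mu> i * (r i \<bullet> w))"
    using arg_cong[OF \<mu>, of "\<lambda>x. x \<bullet> w"] by (simp add: inner_sum_left)
  also have "\<dots> = \<mu> j * (r j \<bullet> w) + (\<Sum>i\<in>J - {j}. \<mu> i * (r i \<bullet> w))"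
    using assms(1) j(1) by (rule sum.remove)
  also have "(\<Sum>i\<in>J - {j}. \<mu> i * (r i \<bullet> w)) = 0"
    using w(2) by (intro sum.neutral) simp
  finally have "r j \<bullet> w = 0"
    using j(2) by simp
  then show thesis
    using w that by (metis DiffI singletonD)
qed

section \<open>Cayley constraints and transverse tuples\<close>

lemma trop_poly_ge:
  "finite A \<Longrightarrow> a \<in> A \<Longrightarrow> c a + real_vec a \<bullet> x \<le> trop_poly A c x"
  by (simp add: trop_poly_def)

lemma trop_poly_eqI:
  assumes "finite A" "a \<in> A" "c a + real_vec a \<bullet> x = m"
    and "\<And>b. b \<in> A \<Longrightarrow> c b + real_vec b \<bullet> x \<le> m"
  shows "trop_poly A c x = m"
  unfolding trop_poly_def using assms by (intro Max_eqI) auto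

lemma finite_local_supp: "finite A \<Longrightarrow> finite (local_supp A c x)"
  by (simp add: local_supp_def)

text \<open>The Cayley trick: \<open>n\<close> polynomials become one system of linear constraints,
  in which the new coordinate \<open>y $ i\<close> bounds the terms of the \<open>i\<close>-th
  polynomial from above.\<close>

definition cayley :: "'n \<times> (int ^ 'n) \<Rightarrow> (real ^ 'n) \<times> (real ^ 'n::finite)"
  where "cayley j = (real_vec (snd j), - axis (fst j) 1)"

lemma cayley_inner: "cayley (i, a) \<bullet> (x, y) = real_vec a \<bullet> x - y $ i"
  by (simp add: cayley_def inner_axis')

lemma cayley_inner': "cayley (i, a) \<bullet> z = real_vec a \<bullet> fst z - snd z $ i"
  by (cases z) (simp add: cayley_inner)

text \<open>A line of solutions through \<open>x\<close> would contradict finiteness of the intersection.\<close>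

lemma transverse_independent:
  fixes P :: "'n::finite \<Rightarrow> (int ^ 'n) set"
  assumes fin: "\<And>i. finite (P i)" and tr: "transverse P c"
    and x: "\<And>i. card (local_supp (P i) (c i) x) \<ge> 2"
  shows "card (local_supp (P i) (c i) x) = 2"
    and "independent_family (SIGMA i:UNIV. local_supp (P i) (c i) x) cayley"
proof -
  let ?S = "SIGMA i:UNIV. local_supp (P i) (c i) x"
  have inter: "u \<in> hypersurface_inter P c \<longleftrightarrow> (\<forall>i. card (local_supp (P i) (c i) u) \<ge> 2)" for u
    by (simp add: hypersurface_inter_def trop_hypersurface_def)
  have two: "card (local_supp (P i) (c i) x) = 2" for i
    using tr x inter unfolding transverse_def smooth_point_def by blast
  then show "card (local_supp (P i) (c i) x) = 2" .
  show "independent_family ?S cayley"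
  proof (rule ccontr)
    assume dep: "\<not> independent_family ?S cayley"
    have finS: "finite ?S"
      by (intro finite_SigmaI finite_local_supp fin) simp
    have cardS: "card ?S = DIM((real ^ 'n) \<times> (real ^ 'n))"
      using fin two by (simp add: card_SigmaI finite_local_supp)
    obtain w where w: "w \<noteq> 0" "\<And>j. j \<in> ?S \<Longrightarrow> cayley j \<bullet> w = 0"
      by (rule dependent_family_orthogonal[OF finS dep eq_refl[OF cardS]]) blast
    define v \<eta> where "v = fst w" and "\<eta> = snd w"
    \<comment> \<open>The line has to move \<open>x\<close>: if \<open>v\<close> were 0, a tight
      term of each polynomial would force \<open>\<eta>\<close> to vanish as well.\<close>
    have v: "v \<noteq> 0"
    proof
      assume "v = 0"
      have "\<eta> $ i = 0" for i
      proof -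
        obtain a where "a \<in> local_supp (P i) (c i) x"
          using two[of i] by fastforce
        then have "cayley (i, a) \<bullet> w = 0"
          using w(2) by blast
        then show ?thesis
          using \<open>v = 0\<close> by (simp add: cayley_inner' v_def \<eta>_def)
      qed
      then show False
        using w(1) \<open>v = 0\<close> by (auto simp: v_def \<eta>_def vec_eq_iff prod_eq_iff)
    qed
    define J where "J = (SIGMA i:UNIV. P i)"
    define h where "h = (\<lambda>(i, a). c i a)"
    define y where "y = (\<chi> i. trop_poly (P i) (c i) x)"
    let ?F = "feasible_face J cayley h ?S"
    have finJ: "finite J"
      unfolding J_def using fin by auto
    have act: "active J cayley h (x, y) = ?S"
      by (auto simp: active_def J_def h_def y_def cayley_inner local_supp_def)
    have "cayley j \<bullet> (x, y) + h j \<le> 0" if "j \<in> J" for j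
    proof -
      obtain i a where "j = (i, a)" "a \<in> P i"
        using \<open>j \<in> J\<close> by (auto simp: J_def)
      then show ?thesis
        using trop_poly_ge[OF fin, of a i "c i" x] by (simp add: cayley_inner h_def y_def)
    qed
    then have p: "(x, y) \<in> ?F"
      by (simp add: feasible_face_def feasible_def act)
    obtain e where e: "e > 0" "(x, y) + e *\<^sub>R w \<in> ?F"
      using feasible_face_move[OF finJ p, of w] w(2) unfolding act by auto
    \<comment> \<open>Convexity keeps the segment in the face, where all terms tight at
      \<open>x\<close> stay tight, so each local support can only grow.\<close>
    have "x + s *\<^sub>R v \<in> hypersurface_inter P c" if s: "s \<in> {0..e}" for s
    proof -
      have "(1 - s / e) *\<^sub>R (x, y) + (s / e) *\<^sub>R ((x, y) + e *\<^sub>R w) \<in> ?F"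
        using s e by (intro convexD[OF convex_feasible_face p e(2)]) auto
      also have "(1 - s / e) *\<^sub>R (x, y) + (s / e) *\<^sub>R ((x, y) + e *\<^sub>R w) = (x + s *\<^sub>R v, y + s *\<^sub>R \<eta>)"
        using e by (auto simp: prod_eq_iff v_def \<eta>_def algebra_simps)
      finally have F: "(x + s *\<^sub>R v, y + s *\<^sub>R \<eta>) \<in> ?F" .
      have "local_supp (P i) (c i) x \<subseteq> local_supp (P i) (c i) (x + s *\<^sub>R v)" for i
      proof
        fix a assume a: "a \<in> local_supp (P i) (c i) x"
        let ?m = "(y + s *\<^sub>R \<eta>) $ i"
        have aP: "a \<in> P i"
          using a by (simp add: local_supp_def)
        have "(i, a) \<in> active J cayley h (x + s *\<^sub>R v, y + s *\<^sub>R \<eta>)"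
          using F a by (auto simp: feasible_face_def)
        then have a_eq: "c i a + real_vec a \<bullet> (x + s *\<^sub>R v) = ?m"
          unfolding active_def mem_Collect_eq cayley_inner h_def by simp
        have "c i b + real_vec b \<bullet> (x + s *\<^sub>R v) \<le> ?m" if "b \<in> P i" for b
        proof -
          have "(i, b) \<in> J"
            using that by (simp add: J_def)
          then have "cayley (i, b) \<bullet> (x + s *\<^sub>R v, y + s *\<^sub>R \<eta>) + h (i, b) \<le> 0"
            using F unfolding feasible_face_def feasible_def by blast
          then show ?thesis
            unfolding cayley_inner h_def by simp
        qed
        then have "trop_poly (P i) (c i) (x + s *\<^sub>R v) = ?m"
          using trop_poly_eqI[of "P i" a "c i" "x + s *\<^sub>R v" ?m] fin aP a_eq by blast
        then show "a \<in> local_supp (P i) (c i) (x + s *\<^sub>R v)"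
          using aP a_eq by (simp add: local_supp_def)
      qed
      then show ?thesis
        unfolding inter by (metis two card_mono fin finite_local_supp)
    qed
    then have "(\<lambda>s. x + s *\<^sub>R v) ` {0..e} \<subseteq> hypersurface_inter P c"
      by blast
    moreover have "finite (hypersurface_inter P c)"
      using tr by (simp add: transverse_def)
    moreover have "inj_on (\<lambda>s. x + s *\<^sub>R v) {0..e}"
      using v by (auto simp: inj_on_def)
    ultimately have "finite {0..e}"
      by (meson finite_imageD finite_subset)
    then show False
      using e(1) by (simp add: infinite_Icc)
  qed
qed

text \<open>A form of the intersection number that also applies at the generic end: only points with
  two terms per polynomial and nonzero weight enter.\<close>

definition slice_sum ::
    "('n::finite \<Rightarrow> (int ^ 'n) set) \<Rightarrow> int ^ 'n \<Rightarrow> ('n \<Rightarrow> int ^ 'n \<Rightarrow> real) \<Rightarrow> bit"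
  where "slice_sum P \<zeta> c = (\<Sum>x\<in>{x. (\<forall>i. card (local_supp (P i) (c i) x) = 2) \<and>
      mixed_weight \<zeta> (\<lambda>i. local_supp (P i) (c i) x) \<noteq> 0}.
    mixed_weight \<zeta> (\<lambda>i. local_supp (P i) (c i) x))"

lemma iota2_eq_slice_sum:
  assumes "transverse P c"
  shows "iota2 P c \<zeta> = slice_sum P \<zeta> c"
proof -
  let ?s = "\<lambda>x i. local_supp (P i) (c i) x"
  have two: "card (?s x i) = 2" if "x \<in> hypersurface_inter P c" for x i
    using assms that unfolding transverse_def smooth_point_def by blast
  have "iota2 P c \<zeta> = (\<Sum>x\<in>hypersurface_inter P c. mixed_weight \<zeta> (?s x))"
    unfolding iota2_def
  proof (rule sum.cong)
    fix x assume x: "x \<in> hypersurface_inter P c"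
    have "segment_mod2 (local_newton (P i) (c i) x) = (\<Sum>a\<in>?s x i. mod2_vec a)" for i
    proof -
      obtain a b where "?s x i = {a, b}" "a \<noteq> b"
        using two[OF x, of i] by (auto simp: card_2_iff)
      then show ?thesis
        using segment_mod2_local_newton[of "P i" "c i" x a b] sum_mod2_vec_pair[of a b] by metis
    qed
    then show "det2 (\<lambda>j. case j of None \<Rightarrow> mod2_vec \<zeta>
        | Some i \<Rightarrow> segment_mod2 (local_newton (P i) (c i) x)) = mixed_weight \<zeta> (?s x)"
      unfolding mixed_weight_def by presburger
  qed simp
  also have "\<dots> = slice_sum P \<zeta> c"
    unfolding slice_sum_def
  proof (rule sum.mono_neutral_right)
    show "finite (hypersurface_inter P c)"
      using assms by (simp add: transverse_def)
  qed (use two in \<open>auto simp: hypersurface_inter_def trop_hypersurface_def\<close>)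
  finally show ?thesis .
qed

text \<open>The homotopy \<open>(1 - t) c + t d\<close> as a polyhedron in the variables \<open>((x, y), t)\<close>: \<open>Inl (i, a)\<close> is the
  constraint that \<open>y $ i\<close> is at least the term of \<open>a\<close> in the \<open>i\<close>-th polynomial, and \<open>Inr False\<close>,
  \<open>Inr True\<close> are the constraints \<open>0 \<le> t\<close>, \<open>t \<le> 1\<close>.\<close>

definition strip_index :: "('n \<Rightarrow> (int ^ 'n) set) \<Rightarrow> ('n \<times> (int ^ 'n) + bool) set"
  where "strip_index P = Inl ` (SIGMA i:UNIV. P i) \<union> range Inr"

definition strip_normal :: "('n::finite \<Rightarrow> int ^ 'n \<Rightarrow> real) \<Rightarrow> ('n \<Rightarrow> int ^ 'n \<Rightarrow> real) \<Rightarrow>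
    'n \<times> (int ^ 'n) + bool \<Rightarrow> ((real ^ 'n) \<times> (real ^ 'n)) \<times> real"
  where "strip_normal c d j = (case j of
      Inl k \<Rightarrow> (cayley k, d (fst k) (snd k) - c (fst k) (snd k))
    | Inr b \<Rightarrow> (0, if b then 1 else - 1))"

definition strip_offset :: "('n \<Rightarrow> int ^ 'n \<Rightarrow> real) \<Rightarrow> 'n \<times> (int ^ 'n) + bool \<Rightarrow> real"
  where "strip_offset c j = (case j of Inl k \<Rightarrow> c (fst k) (snd k) | Inr b \<Rightarrow> if b then - 1 else 0)"

definition fibre :: "('n \<times> 'a + bool) set \<Rightarrow> 'n \<Rightarrow> 'a set"
  where "fibre E i = {a. Inl (i, a) \<in> E}"

text \<open>A tight bound on \<open>t\<close> gives weight 0, so edges lying inside the slices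
  \<open>t = 0\<close> and \<open>t = 1\<close> do not count.\<close>

definition strip_weight :: "int ^ 'n \<Rightarrow> ('n::finite \<times> (int ^ 'n) + bool) set \<Rightarrow> bit"
  where "strip_weight \<zeta> E =
    (if (\<forall>b. Inr b \<notin> E) \<and> (\<forall>i. card (fibre E i) = 2) then mixed_weight \<zeta> (fibre E) else 0)"

lemma index_decompose: "E = Inl ` (SIGMA i:UNIV. fibre E i) \<union> Inr ` (Inr -` E)"
proof -
  have "x \<in> E \<longleftrightarrow> x \<in> Inl ` (SIGMA i:UNIV. fibre E i) \<union> Inr ` (Inr -` E)" for x
    by (cases x) (auto simp: fibre_def)
  then show ?thesis
    by blast
qed

lemma finite_fibre: "finite E \<Longrightarrow> finite (fibre E i)"
  using finite_vimageI[of E "\<lambda>a. Inl (i, a)"] by (simp add: fibre_def vimage_def inj_on_def)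

lemma card_index:
  fixes E :: "('n::finite \<times> 'a + bool) set"
  assumes "finite E"
  shows "card E = (\<Sum>i\<in>UNIV. card (fibre E i)) + card (Inr -` E :: bool set)"
proof -
  define T :: "bool set" where "T = Inr -` E"
  have "card E = card (Inl ` (SIGMA i:UNIV. fibre E i) \<union> Inr ` T :: ('n \<times> 'a + bool) set)"
    unfolding T_def using arg_cong[OF index_decompose[of E], of card] .
  also have "\<dots> = card (SIGMA i:UNIV. fibre E i) + card T"
    using finite_fibre[OF assms] by (subst card_Un_disjoint) (auto simp: card_image inj_on_def)
  also have "card (SIGMA i:UNIV. fibre E i) = (\<Sum>i\<in>UNIV. card (fibre E i))"
    using finite_fibre[OF assms] by (intro card_SigmaI) auto
  finally show ?thesis
    by (simp only: T_def)
qed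

lemma finite_strip_index:
  fixes P :: "'n::finite \<Rightarrow> (int ^ 'n) set"
  assumes "\<And>i. finite (P i)"
  shows "finite (strip_index P)"
  unfolding strip_index_def using assms by auto

lemma strip_inner_Inl:
  "strip_normal c d (Inl (i, a)) \<bullet> ((x, y), t) + strip_offset c (Inl (i, a))
    = (1 - t) * c i a + t * d i a + real_vec a \<bullet> x - y $ i"
  by (simp add: strip_normal_def strip_offset_def cayley_inner algebra_simps)

lemma strip_inner_Inr:
  "strip_normal c d (Inr b) \<bullet> ((x, y), t) + strip_offset c (Inr b) = (if b then t - 1 else - t)"
  by (simp add: strip_normal_def strip_offset_def)

lemma strip_feasible_iff:
  "((x, y), t) \<in> feasible (strip_index P) (strip_normal c d) (strip_offset c) \<longleftrightarrow>
    0 \<le> t \<and> t \<le> 1 \<and> (\<forall>i. \<forall>a\<in>P i. (1 - t) * c i a + t * d i a + real_vec a \<bullet> x \<le> y $ i)"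
proof -
  have "((x, y), t) \<in> feasible (strip_index P) (strip_normal c d) (strip_offset c) \<longleftrightarrow>
      (\<forall>i. \<forall>a\<in>P i. strip_normal c d (Inl (i, a)) \<bullet> ((x, y), t) + strip_offset c (Inl (i, a)) \<le> 0) \<and>
      (\<forall>b. strip_normal c d (Inr b) \<bullet> ((x, y), t) + strip_offset c (Inr b) \<le> 0)"
    unfolding feasible_def strip_index_def by (auto simp: ball_Un)
  then show ?thesis
    unfolding strip_inner_Inl strip_inner_Inr by (auto simp: all_bool_eq)
qed

lemma Inl_active_iff:
  "Inl (i, a) \<in> active (strip_index P) (strip_normal c d) (strip_offset c) ((x, y), t) \<longleftrightarrow>
    a \<in> P i \<and> (1 - t) * c i a + t * d i a + real_vec a \<bullet> x = y $ i"
  unfolding active_def mem_Collect_eq strip_inner_Inl by (auto simp: strip_index_def)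

lemma Inr_active_iff:
  "Inr b \<in> active (strip_index P) (strip_normal c d) (strip_offset c) ((x, y), t) \<longleftrightarrow>
    t = of_bool b"
  unfolding active_def mem_Collect_eq strip_inner_Inr by (auto simp: strip_index_def)

text \<open>Feasibility only bounds \<open>y $ i\<close> from below; one tight term pins it to the
  maximum, and then the tight terms are the local support.\<close>

lemma fibre_active:
  assumes "finite (P i)" "((x, y), t) \<in> feasible (strip_index P) (strip_normal c d) (strip_offset c)"
    and "fibre (active (strip_index P) (strip_normal c d) (strip_offset c) ((x, y), t)) i \<noteq> {}"
  shows "y $ i = trop_poly (P i) (\<lambda>a. (1 - t) * c i a + t * d i a) x"
    and "fibre (active (strip_index P) (strip_normal c d) (strip_offset c) ((x, y), t)) i
      = local_supp (P i) (\<lambda>a. (1 - t) * c i a + t * d i a) x"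
proof -
  obtain a where a: "a \<in> P i" "(1 - t) * c i a + t * d i a + real_vec a \<bullet> x = y $ i"
    using assms(3) unfolding fibre_def Inl_active_iff by blast
  then show y: "y $ i = trop_poly (P i) (\<lambda>a. (1 - t) * c i a + t * d i a) x"
    using assms(2) unfolding strip_feasible_iff
    by (intro trop_poly_eqI[OF assms(1) a(1), symmetric]) auto
  show "fibre (active (strip_index P) (strip_normal c d) (strip_offset c) ((x, y), t)) i
      = local_supp (P i) (\<lambda>a. (1 - t) * c i a + t * d i a) x"
    unfolding fibre_def Inl_active_iff local_supp_def y ..
qed

lemma independent_family_Inl:
  assumes "independent_family S (\<lambda>j. (cayley j, d (fst j) (snd j) - c (fst j) (snd j)))"
  shows "independent_family (Inl ` S) (strip_normal c d)"
  unfolding independent_family_def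
proof (intro allI impI)
  fix \<mu> assume "(\<Sum>j\<in>Inl ` S. \<mu> j *\<^sub>R strip_normal c d j) = 0"
  then have "(\<Sum>j\<in>S. \<mu> (Inl j) *\<^sub>R (cayley j, d (fst j) (snd j) - c (fst j) (snd j))) = 0"
    by (simp add: sum.reindex strip_normal_def)
  then have "\<forall>j\<in>S. \<mu> (Inl j) = 0"
    by (rule assms[unfolded independent_family_def, THEN spec[of _ "\<lambda>j. \<mu> (Inl j)"], THEN mp])
  then show "\<forall>j\<in>Inl ` S. \<mu> j = 0"
    by blast
qed

text \<open>The normal of a bound has only a \<open>t\<close> component. A relation thus projects to
  one among the Cayley vectors, which kills the coefficients on \<open>S\<close> and then the one of
  the bound.\<close>

lemma independent_family_insert_Inr:
  assumes "finite S" "independent_family S cayley"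
  shows "independent_family (insert (Inr b) (Inl ` S)) (strip_normal c d)"
  unfolding independent_family_def
proof (intro allI impI)
  fix \<mu> assume "(\<Sum>j\<in>insert (Inr b) (Inl ` S). \<mu> j *\<^sub>R strip_normal c d j) = 0"
  then have sum: "\<mu> (Inr b) *\<^sub>R (0, if b then 1 else - 1) +
      (\<Sum>j\<in>S. \<mu> (Inl j) *\<^sub>R (cayley j, d (fst j) (snd j) - c (fst j) (snd j))) = 0"
    using assms(1) by (subst (asm) sum.insert) (auto simp: sum.reindex strip_normal_def)
  then have "(\<Sum>j\<in>S. \<mu> (Inl j) *\<^sub>R cayley j) = 0"
    by (simp add: prod_eq_iff fst_sum)
  then have S: "\<forall>j\<in>S. \<mu> (Inl j) = 0"
    by (rule assms(2)[unfolded independent_family_def, THEN spec[of _ "\<lambda>j. \<mu> (Inl j)"], THEN mp])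
  then have "(\<Sum>j\<in>S. \<mu> (Inl j) *\<^sub>R (cayley j, d (fst j) (snd j) - c (fst j) (snd j))) = 0"
    by (intro sum.neutral) (simp add: zero_prod_def)
  then have "\<mu> (Inr b) = 0"
    using sum by (simp add: prod_eq_iff split: if_splits)
  then show "\<forall>j\<in>insert (Inr b) (Inl ` S). \<mu> j = 0"
    using S by blast
qed

text \<open>Independence has three sources: genericity of the segment for \<open>0 < t < 1\<close>,
  genericity of \<open>d\<close> at \<open>t = 1\<close>, and transversality of \<open>c\<close> at
  \<open>t = 0\<close>. The last one speaks only of points where each local support has at least two
  elements, whence \<open>two\<close>.\<close>

lemma strip_active_independent:
  fixes P :: "'n::finite \<Rightarrow> (int ^ 'n) set"
  assumes fin: "\<And>i. finite (P i)" and tr: "transverse P c"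
    and gen: "\<And>S. S \<subseteq> (SIGMA i:UNIV. P i) \<Longrightarrow>
      generic_towards S cayley (\<lambda>j. c (fst j) (snd j)) (\<lambda>j. d (fst j) (snd j))"
    and p: "p \<in> feasible (strip_index P) (strip_normal c d) (strip_offset c)"
    and two: "\<And>i. card (fibre (active (strip_index P) (strip_normal c d) (strip_offset c) p) i) \<ge> 2"
  shows "independent_family (active (strip_index P) (strip_normal c d) (strip_offset c) p)
    (strip_normal c d)"
proof -
  obtain x y t where p_eq: "p = ((x, y), t)"
    by (metis surj_pair)
  let ?A = "active (strip_index P) (strip_normal c d) (strip_offset c) ((x, y), t)"
  define S where "S = (SIGMA i:UNIV. fibre ?A i)"
  have S_iff: "(i, a) \<in> S \<longleftrightarrow> a \<in> P i \<and> (1 - t) * c i a + t * d i a + real_vec a \<bullet> x = y $ i" for i a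
    by (simp add: S_def fibre_def Inl_active_iff)
  have SP: "S \<subseteq> (SIGMA i:UNIV. P i)"
    by (auto simp: S_iff)
  then have finS: "finite S"
    by (rule finite_subset) (use fin in auto)
  have eq: "cayley j \<bullet> (x, y) + ((1 - t) * c (fst j) (snd j) + t * d (fst j) (snd j)) = 0"
    if "j \<in> S" for j
    using that S_iff[of "fst j" "snd j"] cayley_inner[of "fst j" "snd j" x y] by simp
  have A: "?A = Inl ` S \<union> Inr ` {b. t = of_bool b}"
    using index_decompose[of ?A] unfolding S_def by (simp add: vimage_def Inr_active_iff)
  have t: "0 \<le> t" "t \<le> 1"
    using p unfolding p_eq strip_feasible_iff by blast+
  show ?thesis
  proof (cases "0 < t \<and> t < 1")
    case True
    then have A': "?A = Inl ` S"
      unfolding A by auto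
    have "independent_family S (\<lambda>j. (cayley j, d (fst j) (snd j) - c (fst j) (snd j)))"
      using True
      by (intro generic_towards_inside[where t = t and z = "(x, y)", OF gen[OF SP] _ _ eq]) simp_all
    then show ?thesis
      unfolding p_eq A' by (rule independent_family_Inl)
  next
    case False
    then have "t = of_bool False \<or> t = of_bool True"
      using t by auto
    then obtain b where b: "t = of_bool b"
      by blast
    have "{b'. t = of_bool b'} = {b}"
      using b by auto
    then have A': "?A = insert (Inr b) (Inl ` S)"
      unfolding A by auto
    have "independent_family S cayley"
    proof (cases b)
      case True
      then show ?thesis
        using generic_towards_end[OF gen[OF SP], of "(x, y)"] eq b by simp
    next
      case False
      then have t0: "t = 0"
        using b by simp
      have fib: "fibre ?A i = local_supp (P i) (c i) x" for i
        using fibre_active(2)[of P i x y t c d] fin[of i] p two[of i] unfolding p_eq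
        by (fastforce simp: t0)
      have S_eq: "S = (SIGMA i:UNIV. local_supp (P i) (c i) x)"
        unfolding S_def by (intro Sigma_cong refl fib)
      show ?thesis
        unfolding S_eq
        using transverse_independent(2)[OF fin tr] two unfolding p_eq fib by blast
    qed
    then show ?thesis
      unfolding p_eq A' by (rule independent_family_insert_Inr[OF finS])
  qed
qed

lemma strip_weight_nonzero:
  assumes "strip_weight \<zeta> E \<noteq> 0"
  shows "Inr b \<notin> E" "card (fibre E i) = 2" "mixed_weight \<zeta> (fibre E) \<noteq> 0"
  using assms unfolding strip_weight_def by presburger+

text \<open>The two bounds on \<open>t\<close> force \<open>\<tau> = 0\<close>. This removes the
  slopes \<open>d - c\<close> and leaves a condition on the supports alone.\<close>

lemma strip_no_recession:
  fixes P :: "'n::finite \<Rightarrow> (int ^ 'n) set"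
  assumes dev: "two_developed P \<zeta>" and E: "E \<subseteq> strip_index P" "strip_weight \<zeta> E \<noteq> 0"
    and le: "\<forall>j\<in>strip_index P. strip_normal c d j \<bullet> w \<le> 0"
    and eq: "\<forall>j\<in>E. strip_normal c d j \<bullet> w = 0"
  shows "w = 0"
proof -
  obtain v \<eta> \<tau> where w: "w = ((v, \<eta>), \<tau>)"
    by (metis surj_pair)
  have "strip_normal c d (Inr b) \<bullet> w \<le> 0" for b
    using le by (auto simp: strip_index_def)
  from this[of True] this[of False] have \<tau>: "\<tau> = 0"
    by (simp add: strip_normal_def w)
  have normal: "strip_normal c d (Inl (i, a)) \<bullet> w = real_vec a \<bullet> v - \<eta> $ i" for i a
    by (simp add: strip_normal_def w \<tau> cayley_inner)
  have "real_vec a \<bullet> v \<le> \<eta> $ i" if "a \<in> P i" for i a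
    using le that normal[of i a] by (force simp: strip_index_def)
  moreover have eq': "real_vec a \<bullet> v = \<eta> $ i" if "a \<in> fibre E i" for i a
    using eq that normal[of i a] by (force simp: fibre_def)
  moreover have "fibre E i \<subseteq> P i" for i
    using E(1) by (auto simp: fibre_def strip_index_def)
  ultimately have v: "v = 0"
    using two_developed_no_recession[OF dev strip_weight_nonzero(3)[OF E(2)],
        where v = v and \<eta> = "\<lambda>i. \<eta> $ i"] strip_weight_nonzero(2)[OF E(2)] by blast
  have "\<eta> $ i = 0" for i
  proof -
    obtain a where "a \<in> fibre E i"
      using strip_weight_nonzero(2)[OF E(2), of i] by fastforce
    then show ?thesis
      using eq' v by force
  qed
  then show ?thesis
    by (simp add: w \<tau> v vec_eq_iff prod_eq_iff)
qed

section \<open>The sum of the edge weights at a vertex\<close>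

lemma fibre_minus_Inl: "fibre (A - {Inl (k, a)}) = (fibre A)(k := fibre A k - {a})"
  by (auto simp: fibre_def fun_eq_iff)

lemma fibre_minus_Inr: "fibre (A - {Inr b}) = fibre A"
  by (auto simp: fibre_def fun_eq_iff)

lemma sum_ge_const_eq:
  fixes f :: "'n::finite \<Rightarrow> nat"
  assumes "\<And>i. f i \<ge> m" "(\<Sum>i\<in>UNIV. f i) = m * CARD('n)"
  shows "f i = m"
proof (rule ccontr)
  assume "f i \<noteq> m"
  then have "(\<Sum>i\<in>(UNIV :: 'n set). m) < (\<Sum>i\<in>UNIV. f i)"
    using assms(1) by (intro sum_strict_mono_ex1) (auto intro!: exI[of _ i] simp: order_less_le)
  then show False
    using assms(2) by (simp add: mult.commute)
qed

text \<open>The bound uses up one tight constraint, which leaves exactly two terms per polynomial.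
  Deleting a term keeps the bound, so only the deletion of the bound can carry weight.\<close>

lemma sum_strip_weight_end:
  fixes A :: "('n::finite \<times> (int ^ 'n) + bool) set"
  assumes fin: "finite A" and card: "card A = 2 * CARD('n) + 1" and b: "Inr -` A = {b}"
    and two: "\<And>i. card (fibre A i) \<ge> 2"
  shows "card (fibre A i) = 2"
    and "(\<Sum>j\<in>A. strip_weight \<zeta> (A - {j})) = mixed_weight \<zeta> (fibre A)"
proof -
  have "(\<Sum>i\<in>UNIV. card (fibre A i)) = 2 * CARD('n)"
    using card_index[OF fin] card b by simp
  then have all: "card (fibre A i) = 2" for i
    using sum_ge_const_eq[of 2 "\<lambda>i. card (fibre A i)"] two by blast
  then show "card (fibre A i) = 2" .
  have bA: "Inr b \<in> A" and only: "Inr b' \<in> A \<Longrightarrow> b' = b" for b'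
    using b by auto
  have "(\<Sum>j\<in>A. strip_weight \<zeta> (A - {j})) = (\<Sum>j\<in>{Inr b}. strip_weight \<zeta> (A - {j}))"
  proof (rule sum.mono_neutral_right[OF fin])
    show "\<forall>j\<in>A - {Inr b}. strip_weight \<zeta> (A - {j}) = 0"
      using bA unfolding strip_weight_def by auto
  qed (use bA in auto)
  also have "\<dots> = mixed_weight \<zeta> (fibre A)"
    using all only by (auto simp: strip_weight_def fibre_minus_Inr)
  finally show "(\<Sum>j\<in>A. strip_weight \<zeta> (A - {j})) = mixed_weight \<zeta> (fibre A)" .
qed

lemma sum_three:
  fixes f :: "'a \<Rightarrow> 'b::comm_monoid_add"
  assumes "x \<noteq> y" "y \<noteq> z" "x \<noteq> z"
  shows "sum f {x, y, z} = f x + f y + f z"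
  using assms by (simp add: add.assoc)

text \<open>With no bound tight, exactly one polynomial \<open>k\<close> has three tight terms. A
  deletion elsewhere leaves these three and has weight 0; the three deletions in \<open>k\<close>
  give the edges of a triangle, whose weights cancel.\<close>

lemma sum_strip_weight_inside:
  fixes A :: "('n::finite \<times> (int ^ 'n) + bool) set"
  assumes fin: "finite A" and card: "card A = 2 * CARD('n) + 1" and no: "Inr -` A = {}"
    and two: "\<And>i. card (fibre A i) \<ge> 2"
  shows "(\<Sum>j\<in>A. strip_weight \<zeta> (A - {j})) = 0"
proof -
  have sum: "(\<Sum>i\<in>UNIV. card (fibre A i)) = 2 * CARD('n) + 1"
    using card_index[OF fin] card no by simp
  have "\<exists>k. card (fibre A k) \<noteq> 2"
  proof (rule ccontr)
    assume "\<nexists>k. card (fibre A k) \<noteq> 2"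
    then have "(\<Sum>i\<in>UNIV. card (fibre A i)) = (\<Sum>i\<in>(UNIV :: 'n set). 2)"
      by (intro sum.cong) auto
    then show False
      using sum by simp
  qed
  then obtain k where k: "card (fibre A k) > 2"
    using two by (metis order_less_le)
  have three: "card (fibre A k) = 3" and others: "i \<noteq> k \<Longrightarrow> card (fibre A i) = 2" for i
  proof -
    \<comment> \<open>Lowering the count at \<open>k\<close> by one makes the total exactly
      \<open>2 * CARD('n)\<close> while each count stays at least 2, so all are equal to 2.\<close>
    define f where "f i = (if i = k then card (fibre A k) - 1 else card (fibre A i))" for i
    have "(\<Sum>i\<in>UNIV. f i) + 1 = (\<Sum>i\<in>UNIV. card (fibre A i))"
      using k by (simp add: sum.remove[of UNIV k] f_def)
    then have "(\<Sum>i\<in>UNIV. f i) = 2 * CARD('n)"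
      using sum by simp
    moreover have "f i \<ge> 2" for i
      using two[of i] k by (cases "i = k") (simp_all add: f_def)
    ultimately have f: "f i = 2" for i
      using sum_ge_const_eq[of 2 f] by blast
    show "card (fibre A k) = 3"
      using f[of k] k by (simp add: f_def)
    show "i \<noteq> k \<Longrightarrow> card (fibre A i) = 2" for i
      using f[of i] by (simp add: f_def)
  qed
  obtain a b c where abc: "fibre A k = {a, b, c}" "a \<noteq> b" "b \<noteq> c" "a \<noteq> c"
    using three by (auto simp: card_3_iff)
  have Inr: "Inr b \<notin> A" for b
    using no by auto
  have fibA: "Inl (k, x) \<in> A \<longleftrightarrow> x \<in> {a, b, c}" for x
    using abc(1) by (auto simp: fibre_def)
  let ?B = "{Inl (k, a), Inl (k, b), Inl (k, c)}"
  have "(\<Sum>j\<in>A. strip_weight \<zeta> (A - {j})) = (\<Sum>j\<in>?B. strip_weight \<zeta> (A - {j}))"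
  proof (rule sum.mono_neutral_right[OF fin])
    show "?B \<subseteq> A"
      using fibA by blast
    show "\<forall>j\<in>A - ?B. strip_weight \<zeta> (A - {j}) = 0"
    proof
      fix j assume j: "j \<in> A - ?B"
      obtain i x where ix: "j = Inl (i, x)"
        using j Inr by (metis DiffD1 sumE surj_pair)
      then have "i \<noteq> k"
        using j fibA by auto
      then have "card (fibre (A - {j}) k) = 3"
        using three unfolding ix fibre_minus_Inl by simp
      then have "\<exists>i. card (fibre (A - {j}) i) \<noteq> 2"
        by (intro exI[of _ k]) simp
      then show "strip_weight \<zeta> (A - {j}) = 0"
        unfolding strip_weight_def by presburger
    qed
  qed
  also have "\<dots> = strip_weight \<zeta> (A - {Inl (k, a)}) + strip_weight \<zeta> (A - {Inl (k, b)})
      + strip_weight \<zeta> (A - {Inl (k, c)})"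
    using abc by (intro sum_three) simp_all
  also have "\<dots> = mixed_weight \<zeta> ((fibre A)(k := {b, c})) + mixed_weight \<zeta> ((fibre A)(k := {a, c}))
      + mixed_weight \<zeta> ((fibre A)(k := {a, b}))"
  proof -
    have weight: "strip_weight \<zeta> (A - {Inl (k, x)}) = mixed_weight \<zeta> ((fibre A)(k := F))"
      if "fibre A k - {x} = F" "card F = 2" for x F
    proof -
      have "\<forall>i. card (fibre (A - {Inl (k, x)}) i) = 2"
        unfolding fibre_minus_Inl using that others by simp
      then have "strip_weight \<zeta> (A - {Inl (k, x)}) = mixed_weight \<zeta> (fibre (A - {Inl (k, x)}))"
        unfolding strip_weight_def using Inr by simp
      then show ?thesis
        unfolding fibre_minus_Inl that(1) .
    qed
    have "fibre A k - {a} = {b, c}" "fibre A k - {b} = {a, c}" "fibre A k - {c} = {a, b}"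
      using abc by auto
    then show ?thesis
      using weight abc by (metis card_2_iff)
  qed
  also have "\<dots> = 0"
    using abc by (intro mixed_weight_three_edges)
  finally show ?thesis .
qed

text \<open>The vertices of the weighted graph are sorted by \<open>t\<close>. Since
  \<open>d\<close> enters through genericity alone, two transverse tuples can be compared with the
  same \<open>d\<close>.\<close>

lemma slice_sum_eq:
  fixes P :: "'n::finite \<Rightarrow> (int ^ 'n) set"
  assumes fin: "\<And>i. finite (P i)" and dev: "two_developed P \<zeta>" and tr: "transverse P c"
    and gen: "\<And>S. S \<subseteq> (SIGMA i:UNIV. P i) \<Longrightarrow>
      generic_towards S cayley (\<lambda>j. c (fst j) (snd j)) (\<lambda>j. d (fst j) (snd j))"
  shows "slice_sum P \<zeta> c = slice_sum P \<zeta> d"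
proof -
  let ?J = "strip_index P" and ?r = "strip_normal c d" and ?o = "strip_offset c"
  let ?A = "active ?J ?r ?o" and ?g = "strip_weight \<zeta>"
  have dim: "DIM(((real ^ 'n) \<times> (real ^ 'n)) \<times> real) = 2 * CARD('n) + 1"
    by simp
  have finJ: "finite ?J"
    using finite_strip_index[OF fin] .
  have finA: "finite (?A p)" for p
    using finite_active[OF finJ] .
  \<comment> \<open>Tight sets on a closed face contain \<open>E\<close>, so two tight terms per
    polynomial persist up to its ends, as \<open>strip_active_independent\<close> requires.\<close>
  have two_sub: "card (fibre (?A p) i) \<ge> 2" if "E \<subseteq> ?A p" "?g E \<noteq> 0" for E p i
  proof -
    have "fibre E i \<subseteq> fibre (?A p) i"
      using that(1) by (auto simp: fibre_def)
    then show ?thesis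
      using strip_weight_nonzero(2)[OF that(2), of i] card_mono[OF finite_fibre[OF finA]] by metis
  qed
  define V where "V = {p \<in> feasible ?J ?r ?o. card (?A p) = DIM(((real ^ 'n) \<times> (real ^ 'n)) \<times> real) \<and>
    (\<exists>j\<in>?A p. ?g (?A p - {j}) \<noteq> 0)}"
  have indep: "independent_family (?A p) ?r"
    if "E \<subseteq> ?J" "card E + 1 = DIM(((real ^ 'n) \<times> (real ^ 'n)) \<times> real)" "?g E \<noteq> 0"
      "p \<in> feasible_face ?J ?r ?o E" for E p
    using strip_active_independent[OF fin tr gen, of p] two_sub[of E p] that
    unfolding feasible_face_def by blast
  have norec: "w = 0"
    if "E \<subseteq> ?J" "card E + 1 = DIM(((real ^ 'n) \<times> (real ^ 'n)) \<times> real)" "?g E \<noteq> 0"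
      "\<forall>j\<in>?J. ?r j \<bullet> w \<le> 0" "\<forall>j\<in>E. ?r j \<bullet> w = 0" for E w
    using strip_no_recession[OF dev that(1,3-5)] .
  have finV: "finite V"
    unfolding V_def by (rule weighted_edges_handshake(1)[OF finJ indep norec])
  have total: "(\<Sum>p\<in>V. \<Sum>j\<in>?A p. ?g (?A p - {j})) = 0"
    unfolding V_def by (rule weighted_edges_handshake(2)[OF finJ indep norec])
  have V: "p \<in> feasible ?J ?r ?o" "card (?A p) = 2 * CARD('n) + 1" "card (fibre (?A p) i) \<ge> 2"
    if p: "p \<in> V" for p i
  proof -
    show "p \<in> feasible ?J ?r ?o" "card (?A p) = 2 * CARD('n) + 1"
      using p dim unfolding V_def by simp_all
    obtain j where "?g (?A p - {j}) \<noteq> 0"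
      using p unfolding V_def by blast
    then show "card (fibre (?A p) i) \<ge> 2"
      using two_sub[of "?A p - {j}" p i] by blast
  qed
  define e where "e b = (if b then d else c)" for b
  \<comment> \<open>In a slice a vertex is determined by \<open>x\<close>, because tightness forces
    \<open>y\<close> to list the values of the polynomials.\<close>
  have slice: "(\<Sum>p\<in>{p \<in> V. snd p = of_bool b}. \<Sum>j\<in>?A p. ?g (?A p - {j})) = slice_sum P \<zeta> (e b)" for b
  proof -
    let ?t = "of_bool b :: real"
    let ?s = "\<lambda>x i. local_supp (P i) (e b i) x"
    have e: "(\<lambda>a. (1 - ?t) * c i a + ?t * d i a) = e b i" for i
      by (auto simp: e_def)
    have e': "(1 - ?t) * c i a + ?t * d i a = e b i a" for i a
      by (simp add: e_def)
    have InrA: "Inr -` ?A ((x, y), ?t) = {b}" for x y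
      by (auto simp: Inr_active_iff)
    have fib: "y = (\<chi> i. trop_poly (P i) (e b i) x)" "fibre (?A ((x, y), ?t)) = ?s x"
      if "((x, y), ?t) \<in> feasible ?J ?r ?o" "\<And>i. card (fibre (?A ((x, y), ?t)) i) \<ge> 2" for x y
    proof -
      have ne: "fibre (?A ((x, y), ?t)) i \<noteq> {}" for i
        using that(2)[of i] by auto
      show "y = (\<chi> i. trop_poly (P i) (e b i) x)"
        using fibre_active(1)[OF fin that(1) ne] by (simp add: vec_eq_iff e)
      show "fibre (?A ((x, y), ?t)) = ?s x"
        using fibre_active(2)[OF fin that(1) ne] by (simp add: fun_eq_iff e)
    qed
    show ?thesis
      unfolding slice_sum_def
    proof (rule sum.reindex_bij_witness[where j = "\<lambda>p. fst (fst p)"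
          and i = "\<lambda>x. ((x, \<chi> i. trop_poly (P i) (e b i) x), ?t)"])
      fix p assume p: "p \<in> {p \<in> V. snd p = ?t}"
      then obtain x y where xy: "p = ((x, y), ?t)"
        by (cases p) auto
      have pV: "((x, y), ?t) \<in> V"
        using p xy by simp
      note fib' = fib[OF V(1)[OF pV] V(3)[OF pV]]
      show "((fst (fst p), \<chi> i. trop_poly (P i) (e b i) (fst (fst p))), ?t) = p"
        using fib'(1) by (simp add: xy)
      note ends = sum_strip_weight_end[OF finA V(2)[OF pV] InrA V(3)[OF pV]]
      show sum_eq: "mixed_weight \<zeta> (?s (fst (fst p))) = (\<Sum>j\<in>?A p. ?g (?A p - {j}))"
        using ends(2) fib'(2) by (simp add: xy)
      obtain j where j: "?g (?A p - {j}) \<noteq> 0"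
        using pV unfolding V_def xy by blast
      \<comment> \<open>A set of nonzero weight contains no bound on \<open>t\<close>, so the
        deleted constraint is \<open>Inr b\<close> and the fibres are unchanged.\<close>
      have "mixed_weight \<zeta> (fibre (?A p)) \<noteq> 0"
      proof -
        have "Inr b \<notin> ?A p - {j}"
          using strip_weight_nonzero(1)[OF j] .
        then have "j = Inr b"
          using InrA[of x y] unfolding xy by auto
        then show ?thesis
          using strip_weight_nonzero(3)[OF j] by (simp only: fibre_minus_Inr not_False_eq_True)
      qed
      then show "fst (fst p) \<in> {x. (\<forall>i. card (?s x i) = 2) \<and> mixed_weight \<zeta> (?s x) \<noteq> 0}"
        using ends(1) fib'(2) by (simp add: xy)
    next
      fix x assume "x \<in> {x. (\<forall>i. card (?s x i) = 2) \<and> mixed_weight \<zeta> (?s x) \<noteq> 0}"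
      then have x: "card (?s x i) = 2" "mixed_weight \<zeta> (?s x) \<noteq> 0" for i
        by blast+
      show "fst (fst ((x, \<chi> i. trop_poly (P i) (e b i) x), ?t)) = x"
        by simp
      let ?p = "((x, \<chi> i. trop_poly (P i) (e b i) x), ?t)"
      have feas: "?p \<in> feasible ?J ?r ?o"
        unfolding strip_feasible_iff e' by (auto intro: trop_poly_ge[OF fin])
      have fibp: "fibre (?A ?p) = ?s x"
        by (auto simp: fun_eq_iff fibre_def Inl_active_iff e' local_supp_def)
      have card: "card (?A ?p) = 2 * CARD('n) + 1"
        unfolding card_index[OF finA] fibp InrA using x(1) by (simp add: mult.commute)
      have "Inr b' \<notin> ?A ?p - {Inr b}" for b'
        by (cases b; cases b') (simp_all add: Inr_active_iff)
      then have "?g (?A ?p - {Inr b}) = mixed_weight \<zeta> (?s x)"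
        unfolding strip_weight_def fibre_minus_Inr fibp using x(1) by simp
      then have "\<exists>j\<in>?A ?p. ?g (?A ?p - {j}) \<noteq> 0"
        using x(2) by (intro bexI[of _ "Inr b"]) (simp_all add: Inr_active_iff)
      then have "?p \<in> V"
        unfolding V_def mem_Collect_eq dim using feas card by blast
      then show "?p \<in> {p \<in> V. snd p = ?t}"
        by simp
    qed
  qed
  have inside: "(\<Sum>j\<in>?A p. ?g (?A p - {j})) = 0" if p: "p \<in> V" "snd p \<noteq> 0" "snd p \<noteq> 1" for p
  proof -
    obtain x y t where xy: "p = ((x, y), t)"
      by (metis surj_pair)
    have "Inr -` ?A p = {}"
      using p(2,3) by (auto simp: xy Inr_active_iff)
    then show ?thesis
      using sum_strip_weight_inside[OF finA V(2)[OF p(1)] _ V(3)[OF p(1)]] by blast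
  qed
  let ?V0 = "{p \<in> V. snd p = of_bool False}" and ?V1 = "{p \<in> V. snd p = of_bool True}"
  have "(\<Sum>p\<in>V. \<Sum>j\<in>?A p. ?g (?A p - {j})) = (\<Sum>p\<in>?V0 \<union> ?V1. \<Sum>j\<in>?A p. ?g (?A p - {j}))"
    using finV inside by (intro sum.mono_neutral_right) auto
  also have "\<dots> = slice_sum P \<zeta> (e False) + slice_sum P \<zeta> (e True)"
    unfolding slice[symmetric] using finV by (intro sum.union_disjoint) auto
  finally have "slice_sum P \<zeta> c + slice_sum P \<zeta> d = 0"
    using total by (simp add: e_def)
  then show ?thesis
    by (cases "slice_sum P \<zeta> c"; cases "slice_sum P \<zeta> d") simp_all
qed

theorem theorem2p14:
  fixes P :: "'n::finite \<Rightarrow> (int ^ 'n) set"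
    and \<zeta> :: "int ^ 'n"
    and c c' :: "'n \<Rightarrow> int ^ 'n \<Rightarrow> real"
  assumes "\<And>i. finite (P i)" and "\<And>i. P i \<noteq> {}"
    and "two_developed P \<zeta>"
    and "transverse P c" and "transverse P c'"
  shows "iota2 P c \<zeta> = iota2 P c' \<zeta>"
proof -
  have "finite (SIGMA i:UNIV. P i)"
    using assms(1) by auto
  then obtain d where "\<And>S h. S \<subseteq> (SIGMA i:UNIV. P i) \<Longrightarrow>
      h \<in> {\<lambda>j. c (fst j) (snd j), \<lambda>j. c' (fst j) (snd j)} \<Longrightarrow> generic_towards S cayley h d"
    using generic_towards_exists[of _ "{\<lambda>j. c (fst j) (snd j), \<lambda>j. c' (fst j) (snd j)}"] by blast
  then have gen: "generic_towards S cayley (\<lambda>j. c (fst j) (snd j)) d"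
      "generic_towards S cayley (\<lambda>j. c' (fst j) (snd j)) d" if "S \<subseteq> (SIGMA i:UNIV. P i)" for S
    using that by blast+
  define e where "e i a = d (i, a)" for i a
  have e: "d = (\<lambda>j. e (fst j) (snd j))"
    by (simp add: e_def)
  have "slice_sum P \<zeta> c = slice_sum P \<zeta> e" "slice_sum P \<zeta> c' = slice_sum P \<zeta> e"
    using slice_sum_eq[OF assms(1,3,4)] slice_sum_eq[OF assms(1,3,5)] gen unfolding e by blast+
  then show ?thesis
    using assms(4,5) by (simp add: iota2_eq_slice_sum)
qed

end
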